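(* Let $K$ be a commutative ring, let $\mathcal{C}_K^\circ$ be a $K$-linear triangulated category with split idempotents, and let $N$ be an object of $\mathcal{C}_K^\circ$. Then $0\leq_{\mathrm{cdeg}}N$ if and only if there is a degeneration data $(\mathcal{C}_K^\circ,\mathcal{C}_K,\mathcal{C}_V^\circ,\mathcal{C}_V,\uparrow_K^V,\Phi,t)$ for $\mathcal{C}_K^\circ$ and an object $Q$ of $\mathcal{C}_V^\circ$ such that $t_Q$ is nilpotent, with $$\mathrm{cone}(\Phi(t_Q))\simeq\Phi(\mathrm{cone}(t_Q))\simeq N\quad\text{and}\quad \Phi(Q)\in\mathcal{C}_K^\circ .$$
   Context: A degeneration data for $\mathcal{C}_K^\circ$ consists of: (i) a triangulated category $\mathcal{C}_K$ with split idempotents and a fully faithful embedding $\mathcal{C}_K^\circ\to\mathcal{C}_K$ (via which $\mathcal{C}_K^\circ$ is viewed as a full subcategory of $\mathcal{C}_K$); (ii) a triangulated category $\mathcal{C}_V$ with split idempotents and a full triangulated subcategory $\mathcal{C}_V^\circ$; (iii) triangulated functors $\uparrow_K^V:\mathcal{C}_K\to\mathcal{C}_V$ (written after its argument) and $\Phi:\mathcal{C}_V^\circ\to\mathcal{C}_K$ such that $(\mathcal{C}_K^\circ)\uparrow_K^V\subseteq\mathcal{C}_V^\circ$; (iv) a natural transformation $t:\mathrm{id}_{\mathcal{C}_V}\to\mathrm{id}_{\mathcal{C}_V}$ of triangulated functors such that (v) for each object $M$ of $\mathcal{C}_K^\circ$ the morphism $\Phi(t_{M\uparrow_K^V}):\Phi(M\uparrow_K^V)\to\Phi(M\uparrow_K^V)$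 is a split monomorphism in $\mathcal{C}_K$ with cone $M$. For objects $M,N$ of $\mathcal{C}_K^\circ$, one writes $M\leq_{\mathrm{cdeg}}N$ if there is a degeneration data for $\mathcal{C}_K^\circ$ and an object $Q$ of $\mathcal{C}_V^\circ$ such that $p(Q)\simeq p(M\uparrow_K^V)$ in $\mathcal{C}_V^\circ[t^{-1}]$ and $\Phi(\mathrm{cone}(t_Q))\simeq N$. Here $\mathcal{C}_V^\circ[t^{-1}]$ is the Gabriel-Zisman localisation of $\mathcal{C}_V^\circ$ at the endomorphisms $t_X$ for all objects $X$ of $\mathcal{C}_V^\circ$, and $p:\mathcal{C}_V^\circ\to\mathcal{C}_V^\circ[t^{-1}]$ is the canonical functor. *)

theory Defs
  imports "HOL-Algebra.Module"
begin

section \<open>Categories and functors\<close>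

text \<open>Composition is written in the usual order: \<open>g \<cdot> f\<close> is first \<open>f\<close>, then \<open>g\<close>.
  Nothing is required of the operations outside the sets of objects and arrows.\<close>

record ('o, 'm) cat =
  Obj :: "'o set"
  Arr :: "'m set"
  Dom :: "'m \<Rightarrow> 'o"
  Cod :: "'m \<Rightarrow> 'o"
  Ident :: "'o \<Rightarrow> 'm"
  Comp :: "'m \<Rightarrow> 'm \<Rightarrow> 'm" (infixl "\<cdot>\<index>" 70)

definition Mor :: "('o, 'm, 'x) cat_scheme \<Rightarrow> 'o \<Rightarrow> 'o \<Rightarrow> 'm set" where
  "Mor C X Y = {f \<in> Arr C. Dom C f = X \<and> Cod C f = Y}"

locale category =
  fixes C :: "('o, 'm, 'x) cat_scheme" (structure)
  assumes Dom_Obj: "f \<in> Arr C \<Longrightarrow> Dom C f \<in> Obj C"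
    and Cod_Obj: "f \<in> Arr C \<Longrightarrow> Cod C f \<in> Obj C"
    and Ident_Mor: "X \<in> Obj C \<Longrightarrow> Ident C X \<in> Mor C X X"
    and Comp_Mor: "\<lbrakk>f \<in> Mor C X Y; g \<in> Mor C Y Z\<rbrakk> \<Longrightarrow> g \<cdot> f \<in> Mor C X Z"
    and Comp_Ident: "f \<in> Mor C X Y \<Longrightarrow> f \<cdot> Ident C X = f"
    and Ident_Comp: "f \<in> Mor C X Y \<Longrightarrow> Ident C Y \<cdot> f = f"
    and Comp_assoc: "\<lbrakk>f \<in> Mor C W X; g \<in> Mor C X Y; h \<in> Mor C Y Z\<rbrakk>
                       \<Longrightarrow> (h \<cdot> g) \<cdot> f = h \<cdot> (g \<cdot> f)"

definition iso_arrow :: "('o, 'm, 'x) cat_scheme \<Rightarrow> 'm \<Rightarrow> bool" where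
  "iso_arrow C f \<longleftrightarrow> f \<in> Arr C \<and>
     (\<exists>g \<in> Mor C (Cod C f) (Dom C f).
        g \<cdot>\<^bsub>C\<^esub> f = Ident C (Dom C f) \<and> f \<cdot>\<^bsub>C\<^esub> g = Ident C (Cod C f))"

definition isomorphic :: "('o, 'm, 'x) cat_scheme \<Rightarrow> 'o \<Rightarrow> 'o \<Rightarrow> bool" where
  "isomorphic C X Y \<longleftrightarrow> X \<in> Obj C \<and> Y \<in> Obj C \<and> (\<exists>f \<in> Mor C X Y. iso_arrow C f)"

definition split_mono :: "('o, 'm, 'x) cat_scheme \<Rightarrow> 'm \<Rightarrow> bool" where
  "split_mono C f \<longleftrightarrow> f \<in> Arr C \<and>
     (\<exists>r \<in> Mor C (Cod C f) (Dom C f). r \<cdot>\<^bsub>C\<^esub> f = Ident C (Dom C f))"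

definition split_idempotents :: "('o, 'm, 'x) cat_scheme \<Rightarrow> bool" where
  "split_idempotents C \<longleftrightarrow>
     (\<forall>X \<in> Obj C. \<forall>e \<in> Mor C X X. e \<cdot>\<^bsub>C\<^esub> e = e \<longrightarrow>
        (\<exists>Y \<in> Obj C. \<exists>r \<in> Mor C X Y. \<exists>s \<in> Mor C Y X.
           s \<cdot>\<^bsub>C\<^esub> r = e \<and> r \<cdot>\<^bsub>C\<^esub> s = Ident C Y))"

fun Pow_arr :: "('o, 'm, 'x) cat_scheme \<Rightarrow> 'o \<Rightarrow> 'm \<Rightarrow> nat \<Rightarrow> 'm" where
  "Pow_arr C X f 0 = Ident C X"
| "Pow_arr C X f (Suc n) = f \<cdot>\<^bsub>C\<^esub> Pow_arr C X f n"

record ('o, 'm, 'p, 'n) funct =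
  on_Obj :: "'o \<Rightarrow> 'p"
  on_Arr :: "'m \<Rightarrow> 'n"

locale cat_functor = A: category A + B: category B
  for A :: "('o, 'm, 'x) cat_scheme" (structure)
    and B :: "('p, 'n, 'y) cat_scheme" (structure) +
  fixes F :: "('o, 'm, 'p, 'n, 'z) funct_scheme"
  assumes on_Obj: "X \<in> Obj A \<Longrightarrow> on_Obj F X \<in> Obj B"
    and on_Arr: "f \<in> Mor A X Y \<Longrightarrow> on_Arr F f \<in> Mor B (on_Obj F X) (on_Obj F Y)"
    and on_Ident: "X \<in> Obj A \<Longrightarrow> on_Arr F (Ident A X) = Ident B (on_Obj F X)"
    and on_Comp: "\<lbrakk>f \<in> Mor A X Y; g \<in> Mor A Y Z\<rbrakk>
      \<Longrightarrow> on_Arr F (g \<cdot>\<^bsub>A\<^esub> f) = on_Arr F g \<cdot>\<^bsub>B\<^esub> on_Arr F f"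

definition fully_faithful ::
  "('o, 'm, 'x) cat_scheme \<Rightarrow> ('p, 'n, 'y) cat_scheme \<Rightarrow> ('o, 'm, 'p, 'n, 'z) funct_scheme \<Rightarrow> bool"
  where
  "fully_faithful A B F \<longleftrightarrow>
     (\<forall>X \<in> Obj A. \<forall>Y \<in> Obj A.
        bij_betw (on_Arr F) (Mor A X Y) (Mor B (on_Obj F X) (on_Obj F Y)))"

definition essentially_surjective ::
  "('o, 'm, 'x) cat_scheme \<Rightarrow> ('p, 'n, 'y) cat_scheme \<Rightarrow> ('o, 'm, 'p, 'n, 'z) funct_scheme \<Rightarrow> bool"
  where
  "essentially_surjective A B F \<longleftrightarrow> (\<forall>Y \<in> Obj B. \<exists>X \<in> Obj A. isomorphic B (on_Obj F X) Y)"


section \<open>Additive and linear categories\<close>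

text \<open>\<open>Zero C X Y\<close> is the zero arrow from \<open>X\<close> to \<open>Y\<close>, and \<open>Plus C\<close> adds parallel arrows.\<close>

record ('o, 'm) addcat = "('o, 'm) cat" +
  Zero :: "'o \<Rightarrow> 'o \<Rightarrow> 'm"
  Plus :: "'m \<Rightarrow> 'm \<Rightarrow> 'm"

definition hom_group :: "('o, 'm, 'x) addcat_scheme \<Rightarrow> 'o \<Rightarrow> 'o \<Rightarrow> 'm monoid" where
  "hom_group C X Y = \<lparr>carrier = Mor C X Y, mult = Plus C, one = Zero C X Y\<rparr>"

definition Neg :: "('o, 'm, 'x) addcat_scheme \<Rightarrow> 'm \<Rightarrow> 'm" where
  "Neg C f = inv\<^bsub>hom_group C (Dom C f) (Cod C f)\<^esub> f"

definition zero_object :: "('o, 'm, 'x) cat_scheme \<Rightarrow> 'o \<Rightarrow> bool" where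
  "zero_object C Z \<longleftrightarrow> Z \<in> Obj C \<and>
     (\<forall>X \<in> Obj C. (\<exists>!f. f \<in> Mor C Z X) \<and> (\<exists>!f. f \<in> Mor C X Z))"

locale additive_category = category C
  for C :: "('o, 'm, 'x) addcat_scheme" (structure) +
  assumes hom_comm_group: "\<lbrakk>X \<in> Obj C; Y \<in> Obj C\<rbrakk> \<Longrightarrow> comm_group (hom_group C X Y)"
    and Comp_Plus: "\<lbrakk>f \<in> Mor C X Y; f' \<in> Mor C X Y; g \<in> Mor C Y Z\<rbrakk>
      \<Longrightarrow> g \<cdot> Plus C f f' = Plus C (g \<cdot> f) (g \<cdot> f')"
    and Plus_Comp: "\<lbrakk>f \<in> Mor C X Y; g \<in> Mor C Y Z; g' \<in> Mor C Y Z\<rbrakk>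
      \<Longrightarrow> Plus C g g' \<cdot> f = Plus C (g \<cdot> f) (g' \<cdot> f)"
    and has_zero_object: "\<exists>Z. zero_object C Z"
    and has_biproducts: "\<lbrakk>X \<in> Obj C; Y \<in> Obj C\<rbrakk> \<Longrightarrow>
      \<exists>P \<in> Obj C. \<exists>i \<in> Mor C X P. \<exists>j \<in> Mor C Y P. \<exists>p \<in> Mor C P X. \<exists>q \<in> Mor C P Y.
        p \<cdot> i = Ident C X \<and> q \<cdot> j = Ident C Y \<and> p \<cdot> j = Zero C Y X \<and> q \<cdot> i = Zero C X Y \<and>
        Plus C (i \<cdot> p) (j \<cdot> q) = Ident C P"

text \<open>The components \<open>mult\<close> and \<open>one\<close> of a module record play no role in the locale
  \<open>module\<close>.\<close>

definition hom_module ::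
  "('o, 'm, 'x) addcat_scheme \<Rightarrow> ('k \<Rightarrow> 'm \<Rightarrow> 'm) \<Rightarrow> 'o \<Rightarrow> 'o \<Rightarrow> ('k, 'm) module" where
  "hom_module C sm X Y =
     \<lparr>carrier = Mor C X Y, mult = undefined, one = undefined,
      zero = Zero C X Y, add = Plus C, smult = sm\<rparr>"

locale additive_functor = cat_functor A B F
  for A :: "('o, 'm, 'x) addcat_scheme" (structure)
    and B :: "('p, 'n, 'y) addcat_scheme" (structure)
    and F :: "('o, 'm, 'p, 'n, 'z) funct_scheme" +
  assumes on_Plus: "\<lbrakk>f \<in> Mor A X Y; g \<in> Mor A X Y\<rbrakk>
    \<Longrightarrow> on_Arr F (Plus A f g) = Plus B (on_Arr F f) (on_Arr F g)"

definition nilpotent_endo :: "('o, 'm, 'x) addcat_scheme \<Rightarrow> 'o \<Rightarrow> 'm \<Rightarrow> bool" where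
  "nilpotent_endo C X f \<longleftrightarrow> f \<in> Mor C X X \<and> (\<exists>n. Pow_arr C X f n = Zero C X X)"


section \<open>Triangulated categories\<close>

text \<open>The triple \<open>(f, g, h)\<close> stands for the triangle with \<open>f : X \<rightarrow> Y\<close>, \<open>g : Y \<rightarrow> Z\<close> and
  \<open>h : Z \<rightarrow> T X\<close>, where the shift \<open>T\<close> is given by \<open>ShO\<close> on objects and \<open>ShA\<close> on arrows.\<close>

record ('o, 'm) tricat = "('o, 'm) addcat" +
  ShO :: "'o \<Rightarrow> 'o"
  ShA :: "'m \<Rightarrow> 'm"
  Dist :: "('m \<times> 'm \<times> 'm) set"

definition shift :: "('o, 'm, 'x) tricat_scheme \<Rightarrow> ('o, 'm, 'o, 'm) funct" where
  "shift C = \<lparr>on_Obj = ShO C, on_Arr = ShA C\<rparr>"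

definition triangles :: "('o, 'm, 'x) tricat_scheme \<Rightarrow> ('m \<times> 'm \<times> 'm) set" where
  "triangles C = {(f, g, h). f \<in> Arr C \<and> g \<in> Arr C \<and> h \<in> Arr C \<and>
     Cod C f = Dom C g \<and> Cod C g = Dom C h \<and> Cod C h = ShO C (Dom C f)}"

text \<open>The shift is an additive self-equivalence, not necessarily an automorphism.\<close>

locale triangulated_category = additive_category C + shift: additive_functor C C "shift C"
  for C :: "('o, 'm, 'x) tricat_scheme" (structure) +
  assumes shift_fully_faithful: "fully_faithful C C (shift C)"
    and shift_essentially_surjective: "essentially_surjective C C (shift C)"
    and Dist_triangles: "Dist C \<subseteq> triangles C"
    and TR1_iso: "\<lbrakk>(f, g, h) \<in> Dist C; (f', g', h') \<in> triangles C;
        a \<in> Mor C (Dom C f) (Dom C f'); b \<in> Mor C (Dom C g) (Dom C g');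
        c \<in> Mor C (Dom C h) (Dom C h'); iso_arrow C a; iso_arrow C b; iso_arrow C c;
        b \<cdot> f = f' \<cdot> a; c \<cdot> g = g' \<cdot> b; ShA C a \<cdot> h = h' \<cdot> c\<rbrakk>
      \<Longrightarrow> (f', g', h') \<in> Dist C"
    and TR1_ident: "\<lbrakk>X \<in> Obj C; zero_object C Z\<rbrakk>
      \<Longrightarrow> (Ident C X, Zero C X Z, Zero C Z (ShO C X)) \<in> Dist C"
    and TR1_cone: "f \<in> Arr C \<Longrightarrow> \<exists>g h. (f, g, h) \<in> Dist C"
    and TR2: "(f, g, h) \<in> triangles C
      \<Longrightarrow> (f, g, h) \<in> Dist C \<longleftrightarrow> (g, h, Neg C (ShA C f)) \<in> Dist C"
    and TR3: "\<lbrakk>(f, g, h) \<in> Dist C; (f', g', h') \<in> Dist C;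
        a \<in> Mor C (Dom C f) (Dom C f'); b \<in> Mor C (Dom C g) (Dom C g'); b \<cdot> f = f' \<cdot> a\<rbrakk>
      \<Longrightarrow> \<exists>c \<in> Mor C (Dom C h) (Dom C h'). c \<cdot> g = g' \<cdot> b \<and> ShA C a \<cdot> h = h' \<cdot> c"
    and TR4: "\<lbrakk>f \<in> Mor C X Y; g \<in> Mor C Y Z;
        (f, f1, f2) \<in> Dist C; (g, g1, g2) \<in> Dist C; (g \<cdot> f, k1, k2) \<in> Dist C\<rbrakk>
      \<Longrightarrow> \<exists>u \<in> Mor C (Cod C f1) (Cod C k1). \<exists>v \<in> Mor C (Cod C k1) (Cod C g1).
            (u, v, ShA C f1 \<cdot> g2) \<in> Dist C \<and>
            u \<cdot> f1 = k1 \<cdot> g \<and> k2 \<cdot> u = f2 \<and> v \<cdot> k1 = g1 \<and> g2 \<cdot> v = ShA C f \<cdot> k2"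

locale linear_triangulated_category = cring K + triangulated_category C
  for K :: "('k, 'r) ring_scheme" (structure)
    and C :: "('o, 'm, 'x) tricat_scheme" (structure) +
  fixes sm :: "'k \<Rightarrow> 'm \<Rightarrow> 'm"
  assumes hom_module: "\<lbrakk>X \<in> Obj C; Y \<in> Obj C\<rbrakk> \<Longrightarrow> module K (hom_module C sm X Y)"
    and sm_Comp: "\<lbrakk>k \<in> carrier K; f \<in> Mor C X Y; g \<in> Mor C Y Z\<rbrakk>
      \<Longrightarrow> sm k g \<cdot>\<^bsub>C\<^esub> f = sm k (g \<cdot>\<^bsub>C\<^esub> f)"
    and Comp_sm: "\<lbrakk>k \<in> carrier K; f \<in> Mor C X Y; g \<in> Mor C Y Z\<rbrakk>
      \<Longrightarrow> g \<cdot>\<^bsub>C\<^esub> sm k f = sm k (g \<cdot>\<^bsub>C\<^esub> f)"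
    and shift_sm: "\<lbrakk>k \<in> carrier K; f \<in> Mor C X Y\<rbrakk> \<Longrightarrow> ShA C (sm k f) = sm k (ShA C f)"

text \<open>A cone is determined only up to isomorphism; \<open>cone\<close> chooses one.\<close>

definition cone :: "('o, 'm, 'x) tricat_scheme \<Rightarrow> 'm \<Rightarrow> 'o" where
  "cone C f = (SOME Z. \<exists>g h. (f, g, h) \<in> Dist C \<and> Cod C g = Z)"

definition full_sub :: "('o, 'm, 'x) tricat_scheme \<Rightarrow> 'o set \<Rightarrow> ('o, 'm, 'x) tricat_scheme" where
  "full_sub C S = C\<lparr>Obj := S,
     Arr := {f \<in> Arr C. Dom C f \<in> S \<and> Cod C f \<in> S},
     Dist := {(f, g, h) \<in> Dist C. Dom C f \<in> S \<and> Dom C g \<in> S \<and> Dom C h \<in> S}\<rparr>"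

text \<open>Closure under the shift (up to isomorphism also under its inverse), biproducts and
  cones is contained in the requirement that the induced structure is triangulated. The
  subcategory need not be closed under isomorphism in the ambient category.\<close>

definition full_triangulated_sub :: "('o, 'm, 'x) tricat_scheme \<Rightarrow> 'o set \<Rightarrow> bool" where
  "full_triangulated_sub C S \<longleftrightarrow> S \<subseteq> Obj C \<and> triangulated_category (full_sub C S)"

text \<open>A triangulated functor \<open>F\<close> carries a natural isomorphism
  \<open>on_Shift F X : F (T X) \<rightarrow> T (F X)\<close>.\<close>

record ('o, 'm, 'p, 'n) trifunct = "('o, 'm, 'p, 'n) funct" +
  on_Shift :: "'o \<Rightarrow> 'n"

locale triangulated_functor =
  A: triangulated_category A + B: triangulated_category B + additive_functor A B F
  for A :: "('o, 'm, 'x) tricat_scheme" (structure)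
    and B :: "('p, 'n, 'y) tricat_scheme" (structure)
    and F :: "('o, 'm, 'p, 'n, 'z) trifunct_scheme" +
  assumes on_Shift_Mor: "X \<in> Obj A
      \<Longrightarrow> on_Shift F X \<in> Mor B (on_Obj F (ShO A X)) (ShO B (on_Obj F X))"
    and on_Shift_iso: "X \<in> Obj A \<Longrightarrow> iso_arrow B (on_Shift F X)"
    and on_Shift_natural: "f \<in> Mor A X Y \<Longrightarrow>
      ShA B (on_Arr F f) \<cdot>\<^bsub>B\<^esub> on_Shift F X = on_Shift F Y \<cdot>\<^bsub>B\<^esub> on_Arr F (ShA A f)"
    and on_Dist: "(f, g, h) \<in> Dist A \<Longrightarrow>
      (on_Arr F f, on_Arr F g, on_Shift F (Dom A f) \<cdot>\<^bsub>B\<^esub> on_Arr F h) \<in> Dist B"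

text \<open>Since the identity functor commutes strictly with the shift, compatibility of a natural
  transformation between identity functors with the shift means \<open>T (t X) = t (T X)\<close>.\<close>

definition tri_nat_endo_id :: "('o, 'm, 'x) tricat_scheme \<Rightarrow> ('o \<Rightarrow> 'm) \<Rightarrow> bool" where
  "tri_nat_endo_id C t \<longleftrightarrow>
     (\<forall>X \<in> Obj C. t X \<in> Mor C X X) \<and>
     (\<forall>X \<in> Obj C. \<forall>Y \<in> Obj C. \<forall>f \<in> Mor C X Y. t Y \<cdot>\<^bsub>C\<^esub> f = f \<cdot>\<^bsub>C\<^esub> t X) \<and>
     (\<forall>X \<in> Obj C. ShA C (t X) = t (ShO C X))"


section \<open>Gabriel-Zisman localisation\<close>

text \<open>Arrows of the localisation of \<open>C\<close> at \<open>S\<close> are classes of zigzags. A zigzag is listed in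
  the order in which it is travelled; \<open>Bwd s\<close> is the formal inverse of \<open>s \<in> S\<close>. An arrow
  is a class of zigzags tagged with its domain and codomain.\<close>

datatype 'm step = Fwd 'm | Bwd 'm

fun step_ok :: "('o, 'm, 'x) cat_scheme \<Rightarrow> 'm set \<Rightarrow> 'm step \<Rightarrow> bool" where
  "step_ok C S (Fwd f) \<longleftrightarrow> f \<in> Arr C"
| "step_ok C S (Bwd s) \<longleftrightarrow> s \<in> S"

fun step_src :: "('o, 'm, 'x) cat_scheme \<Rightarrow> 'm step \<Rightarrow> 'o" where
  "step_src C (Fwd f) = Dom C f"
| "step_src C (Bwd s) = Cod C s"

fun step_tgt :: "('o, 'm, 'x) cat_scheme \<Rightarrow> 'm step \<Rightarrow> 'o" where
  "step_tgt C (Fwd f) = Cod C f"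
| "step_tgt C (Bwd s) = Dom C s"

fun is_zigzag :: "('o, 'm, 'x) cat_scheme \<Rightarrow> 'm set \<Rightarrow> 'o \<Rightarrow> 'm step list \<Rightarrow> 'o \<Rightarrow> bool" where
  "is_zigzag C S X [] Y \<longleftrightarrow> X \<in> Obj C \<and> X = Y"
| "is_zigzag C S X (a # as) Y \<longleftrightarrow>
     step_ok C S a \<and> step_src C a = X \<and> is_zigzag C S (step_tgt C a) as Y"

definition zigzags :: "('o, 'm, 'x) cat_scheme \<Rightarrow> 'm set \<Rightarrow> 'o \<Rightarrow> 'o \<Rightarrow> 'm step list set" where
  "zigzags C S X Y = {as. is_zigzag C S X as Y}"

inductive zigzag_rule ::
  "('o, 'm, 'x) cat_scheme \<Rightarrow> 'm set \<Rightarrow> 'm step list \<Rightarrow> 'm step list \<Rightarrow> bool"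
  for C :: "('o, 'm, 'x) cat_scheme" and S :: "'m set" where
  rule_ident: "X \<in> Obj C \<Longrightarrow> zigzag_rule C S [Fwd (Ident C X)] []"
| rule_comp: "\<lbrakk>f \<in> Arr C; g \<in> Arr C; Cod C f = Dom C g\<rbrakk>
    \<Longrightarrow> zigzag_rule C S [Fwd f, Fwd g] [Fwd (g \<cdot>\<^bsub>C\<^esub> f)]"
| rule_inv_left: "s \<in> S \<Longrightarrow> zigzag_rule C S [Fwd s, Bwd s] []"
| rule_inv_right: "s \<in> S \<Longrightarrow> zigzag_rule C S [Bwd s, Fwd s] []"

definition zigzag_step ::
  "('o, 'm, 'x) cat_scheme \<Rightarrow> 'm set \<Rightarrow> 'o \<Rightarrow> 'o \<Rightarrow> ('m step list \<times> 'm step list) set" where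
  "zigzag_step C S X Y =
     {(us @ l @ vs, us @ r @ vs) | us vs l r. zigzag_rule C S l r \<and>
        us @ l @ vs \<in> zigzags C S X Y \<and> us @ r @ vs \<in> zigzags C S X Y}"

definition zigzag_equiv ::
  "('o, 'm, 'x) cat_scheme \<Rightarrow> 'm set \<Rightarrow> 'o \<Rightarrow> 'o \<Rightarrow> ('m step list \<times> 'm step list) set" where
  "zigzag_equiv C S X Y =
     (zigzag_step C S X Y \<union> (zigzag_step C S X Y)\<inverse>)\<^sup>* \<inter> zigzags C S X Y \<times> zigzags C S X Y"

type_synonym ('o, 'm) gz_arrow = "'o \<times> 'o \<times> 'm step list set"

definition gz_class ::
  "('o, 'm, 'x) cat_scheme \<Rightarrow> 'm set \<Rightarrow> 'o \<Rightarrow> 'o \<Rightarrow> 'm step list \<Rightarrow> ('o, 'm) gz_arrow" where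
  "gz_class C S X Y as = (X, Y, zigzag_equiv C S X Y `` {as})"

fun gz_comp :: "('o, 'm, 'x) cat_scheme \<Rightarrow> 'm set
    \<Rightarrow> ('o, 'm) gz_arrow \<Rightarrow> ('o, 'm) gz_arrow \<Rightarrow> ('o, 'm) gz_arrow" where
  "gz_comp C S (Y', Z, B) (X, Y, A) =
     (X, Z, \<Union>a \<in> A. \<Union>b \<in> B. zigzag_equiv C S X Z `` {a @ b})"

definition gz_localisation ::
  "('o, 'm, 'x) cat_scheme \<Rightarrow> 'm set \<Rightarrow> ('o, ('o, 'm) gz_arrow) cat" where
  "gz_localisation C S =
     \<lparr>Obj = Obj C,
      Arr = {(X, Y, A) | X Y A. A \<in> zigzags C S X Y // zigzag_equiv C S X Y},
      Dom = (\<lambda>(X, Y, A). X),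
      Cod = (\<lambda>(X, Y, A). Y),
      Ident = (\<lambda>X. gz_class C S X X []),
      Comp = gz_comp C S\<rparr>"

definition gz_functor ::
  "('o, 'm, 'x) cat_scheme \<Rightarrow> 'm set \<Rightarrow> ('o, 'm, 'o, ('o, 'm) gz_arrow) funct" where
  "gz_functor C S =
     \<lparr>on_Obj = (\<lambda>X. X), on_Arr = (\<lambda>f. gz_class C S (Dom C f) (Cod C f) [Fwd f])\<rparr>"

text \<open>The localisation is a category and \<open>gz_functor\<close> is a functor inverting \<open>S\<close>; every
  functor inverting \<open>S\<close> factors uniquely through it, by \<open>gz_lift\<close>.\<close>

lemma zigzag_append:
  "is_zigzag C S X (as @ bs) Z \<longleftrightarrow> (\<exists>Y. is_zigzag C S X as Y \<and> is_zigzag C S Y bs Z)"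
  if "category C" "S \<subseteq> Arr C"
proof (induction as arbitrary: X)
  case Nil
  interpret category C by fact
  have "X \<in> Obj C" if "is_zigzag C S X bs Z"
  proof (cases bs)
    case Nil
    then show ?thesis using that by auto
  next
    case (Cons a cs)
    then show ?thesis
      using that Dom_Obj Cod_Obj \<open>S \<subseteq> Arr C\<close> by (cases a) auto
  qed
  then show ?case by auto
qed auto

lemma zigzag_Obj:
  assumes "category C" "S \<subseteq> Arr C" "is_zigzag C S X as Y"
  shows "X \<in> Obj C" "Y \<in> Obj C"
proof -
  show "X \<in> Obj C"
    using zigzag_append[OF assms(1,2), of X "[]" as Y] assms(3) by simp
  show "Y \<in> Obj C"
    using assms(3) by (induction as arbitrary: X) auto
qed

lemma zigzag_equiv_equiv: "equiv (zigzags C S X Y) (zigzag_equiv C S X Y)"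
proof (rule equivI)
  let ?r = "zigzag_step C S X Y \<union> (zigzag_step C S X Y)\<inverse>"
  have sym: "sym (?r\<^sup>*)"
    by (rule sym_rtrancl) (auto simp: sym_def)
  show "zigzag_equiv C S X Y \<subseteq> zigzags C S X Y \<times> zigzags C S X Y"
    by (auto simp: zigzag_equiv_def)
  show "refl_on (zigzags C S X Y) (zigzag_equiv C S X Y)"
    by (auto simp: zigzag_equiv_def refl_on_def)
  show "sym (zigzag_equiv C S X Y)"
    using sym by (auto simp: zigzag_equiv_def sym_def)
  show "trans (zigzag_equiv C S X Y)"
    by (auto simp: zigzag_equiv_def trans_def intro: rtrancl_trans)
qed

lemma zigzag_stepI:
  assumes "zigzag_rule C S l r" "us @ l @ vs \<in> zigzags C S X Y" "us @ r @ vs \<in> zigzags C S X Y"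
  shows "(us @ l @ vs, us @ r @ vs) \<in> zigzag_step C S X Y"
  unfolding zigzag_step_def using assms by blast

lemma zigzag_step_equiv: "zigzag_step C S X Y \<subseteq> zigzag_equiv C S X Y"
  unfolding zigzag_equiv_def zigzag_step_def by blast

lemma zigzag_equiv_mono:
  assumes "(as, bs) \<in> zigzag_equiv C S X Y"
    and "\<And>cs ds. (cs, ds) \<in> zigzag_step C S X Y \<Longrightarrow> (F cs, F ds) \<in> zigzag_equiv C S X' Y'"
    and "F as \<in> zigzags C S X' Y'"
  shows "(F as, F bs) \<in> zigzag_equiv C S X' Y'"
proof -
  note e = zigzag_equiv_equiv[of C S X' Y']
  have "(as, bs) \<in> (zigzag_step C S X Y \<union> (zigzag_step C S X Y)\<inverse>)\<^sup>*"
    using assms(1) by (auto simp: zigzag_equiv_def)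
  then show ?thesis
  proof induction
    case base
    then show ?case using assms(3) e by (auto simp: equiv_def refl_on_def)
  next
    case (step cs ds)
    have "sym (zigzag_equiv C S X' Y')" using e by (rule equivE)
    then have "(F cs, F ds) \<in> zigzag_equiv C S X' Y'"
      using assms(2) step.hyps(2) by (blast dest: symD)
    with step.IH show ?case using e by (meson equivE transD)
  qed
qed

lemma zigzag_equiv_append:
  assumes "category C" "S \<subseteq> Arr C"
    and "(as, as') \<in> zigzag_equiv C S X Y" "(bs, bs') \<in> zigzag_equiv C S Y Z"
  shows "(as @ bs, as' @ bs') \<in> zigzag_equiv C S X Z"
proof -
  have z: "as \<in> zigzags C S X Y" "as' \<in> zigzags C S X Y"
      "bs \<in> zigzags C S Y Z" "bs' \<in> zigzags C S Y Z"
    using assms(3,4) by (auto simp: zigzag_equiv_def)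
  have app: "cs @ ds \<in> zigzags C S X Z"
    if "cs \<in> zigzags C S X Y" "ds \<in> zigzags C S Y Z" for cs ds
    using that zigzag_append[OF assms(1,2)] by (auto simp: zigzags_def)
  have "(as @ bs, as' @ bs) \<in> zigzag_equiv C S X Z"
  proof (rule zigzag_equiv_mono[where F = "\<lambda>cs. cs @ bs", OF assms(3)])
    fix cs ds assume "(cs, ds) \<in> zigzag_step C S X Y"
    then obtain us l r vs where *: "cs = us @ l @ vs" "ds = us @ r @ vs" "zigzag_rule C S l r"
        "cs \<in> zigzags C S X Y" "ds \<in> zigzags C S X Y"
      unfolding zigzag_step_def by blast
    have "(us @ l @ (vs @ bs), us @ r @ (vs @ bs)) \<in> zigzag_step C S X Z"
      using app[OF *(4) z(3)] app[OF *(5) z(3)]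
      by - (rule zigzag_stepI[OF *(3)], simp_all add: *(1,2))
    then show "(cs @ bs, ds @ bs) \<in> zigzag_equiv C S X Z"
      using subsetD[OF zigzag_step_equiv] *(1,2) by (metis append.assoc)
  qed (rule app[OF z(1,3)])
  moreover have "(as' @ bs, as' @ bs') \<in> zigzag_equiv C S X Z"
  proof (rule zigzag_equiv_mono[where F = "\<lambda>cs. as' @ cs", OF assms(4)])
    fix cs ds assume "(cs, ds) \<in> zigzag_step C S Y Z"
    then obtain us l r vs where *: "cs = us @ l @ vs" "ds = us @ r @ vs" "zigzag_rule C S l r"
        "cs \<in> zigzags C S Y Z" "ds \<in> zigzags C S Y Z"
      unfolding zigzag_step_def by blast
    have "((as' @ us) @ l @ vs, (as' @ us) @ r @ vs) \<in> zigzag_step C S X Z"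
      using app[OF z(2) *(4)] app[OF z(2) *(5)]
      by - (rule zigzag_stepI[OF *(3)], simp_all add: *(1,2))
    then show "(as' @ cs, as' @ ds) \<in> zigzag_equiv C S X Z"
      using subsetD[OF zigzag_step_equiv] *(1,2) by (metis append.assoc)
  qed (rule app[OF z(2,3)])
  moreover have "trans (zigzag_equiv C S X Z)"
    using zigzag_equiv_equiv by (rule equivE)
  ultimately show ?thesis by (blast dest: transD)
qed

lemma gz_class_eq:
  assumes "(as, bs) \<in> zigzag_equiv C S X Y"
  shows "gz_class C S X Y as = gz_class C S X Y bs"
  using equiv_class_eq[OF zigzag_equiv_equiv assms] by (simp add: gz_class_def)

lemma gz_Mor:
  "Mor (gz_localisation C S) X Y = gz_class C S X Y ` zigzags C S X Y"
  by (auto simp: Mor_def gz_localisation_def gz_class_def quotient_def image_iff)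

lemma gz_comp_class:
  assumes "category C" "S \<subseteq> Arr C" "as \<in> zigzags C S X Y" "bs \<in> zigzags C S Y Z"
  shows "gz_comp C S (gz_class C S Y Z bs) (gz_class C S X Y as) = gz_class C S X Z (as @ bs)"
proof -
  have "zigzag_equiv C S X Z `` {as' @ bs'} = zigzag_equiv C S X Z `` {as @ bs}"
    if "as' \<in> zigzag_equiv C S X Y `` {as}" "bs' \<in> zigzag_equiv C S Y Z `` {bs}" for as' bs'
    using that zigzag_equiv_append[OF assms(1,2)]
    by (intro equiv_class_eq[OF zigzag_equiv_equiv, symmetric]) auto
  moreover have "as \<in> zigzag_equiv C S X Y `` {as}" "bs \<in> zigzag_equiv C S Y Z `` {bs}"
    by (rule equiv_class_self[OF zigzag_equiv_equiv assms(3)],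
        rule equiv_class_self[OF zigzag_equiv_equiv assms(4)])
  ultimately have "(\<Union>a \<in> zigzag_equiv C S X Y `` {as}. \<Union>b \<in> zigzag_equiv C S Y Z `` {bs}.
      zigzag_equiv C S X Z `` {a @ b}) = zigzag_equiv C S X Z `` {as @ bs}"
    by blast
  then show ?thesis by (simp add: gz_class_def)
qed

lemma zigzags_append:
  assumes "category C" "S \<subseteq> Arr C" "as \<in> zigzags C S X Y" "bs \<in> zigzags C S Y Z"
  shows "as @ bs \<in> zigzags C S X Z"
  using assms zigzag_append[OF assms(1,2)] by (auto simp: zigzags_def)

lemma category_gz:
  assumes "category C" "S \<subseteq> Arr C"
  shows "category (gz_localisation C S)"
proof -
  let ?G = "gz_localisation C S"
  have [simp]: "Obj ?G = Obj C" "Ident ?G X = gz_class C S X X []" "Comp ?G = gz_comp C S" for X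
    by (simp_all add: gz_localisation_def)
  note comp = gz_comp_class[OF assms] zigzags_append[OF assms]
  show ?thesis
  proof
    fix f assume f: "f \<in> Arr ?G"
    then have "f \<in> Mor ?G (Dom ?G f) (Cod ?G f)" by (simp add: Mor_def)
    then obtain as where "as \<in> zigzags C S (Dom ?G f) (Cod ?G f)" by (auto simp: gz_Mor)
    then show "Dom ?G f \<in> Obj ?G" "Cod ?G f \<in> Obj ?G"
      using zigzag_Obj[OF assms] by (auto simp: zigzags_def)
  next
    fix X assume "X \<in> Obj ?G"
    then show "Ident ?G X \<in> Mor ?G X X"
      by (auto simp: gz_Mor zigzags_def)
  next
    fix f X Y assume "f \<in> Mor ?G X Y"
    then obtain as where as: "as \<in> zigzags C S X Y" "f = gz_class C S X Y as"
      by (auto simp: gz_Mor)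
    have n: "[] \<in> zigzags C S X X" "[] \<in> zigzags C S Y Y"
      using as(1) zigzag_Obj[OF assms] by (auto simp: zigzags_def)
    show "f \<cdot>\<^bsub>?G\<^esub> Ident ?G X = f" "Ident ?G Y \<cdot>\<^bsub>?G\<^esub> f = f"
      using as n by (simp_all add: comp)
  qed (auto simp: gz_Mor comp)
qed

lemma functor_gz:
  assumes "category C" "S \<subseteq> Arr C"
  shows "cat_functor C (gz_localisation C S) (gz_functor C S)"
proof -
  interpret category C by fact
  have z: "[Fwd f] \<in> zigzags C S X Y" if "f \<in> Mor C X Y" for f X Y
    using that Cod_Obj by (auto simp: zigzags_def Mor_def)
  show ?thesis
  proof (intro cat_functor.intro cat_functor_axioms.intro category_gz assms)
    fix X assume X: "X \<in> Obj C"
    then have *: "Ident C X \<in> Mor C X X" by (rule Ident_Mor)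
    have "([] @ [Fwd (Ident C X)] @ [], [] @ [] @ []) \<in> zigzag_step C S X X"
      using z[OF *] X by - (rule zigzag_stepI, rule rule_ident, simp_all add: zigzags_def)
    then show "on_Arr (gz_functor C S) (Ident C X)
        = Ident (gz_localisation C S) (on_Obj (gz_functor C S) X)"
      using * gz_class_eq[OF subsetD[OF zigzag_step_equiv]]
      by (simp add: gz_functor_def gz_localisation_def Mor_def)
  next
    fix f g X Y Z assume fg: "f \<in> Mor C X Y" "g \<in> Mor C Y Z"
    then have gf: "g \<cdot>\<^bsub>C\<^esub> f \<in> Mor C X Z" by (rule Comp_Mor)
    have "([] @ [Fwd f, Fwd g] @ [], [] @ [Fwd (g \<cdot>\<^bsub>C\<^esub> f)] @ []) \<in> zigzag_step C S X Z"
      using z[OF gf] zigzags_append[OF assms z[OF fg(1)] z[OF fg(2)]] fg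
      by - (rule zigzag_stepI, rule rule_comp, simp_all add: Mor_def)
    then have "gz_class C S X Z [Fwd f, Fwd g] = gz_class C S X Z [Fwd (g \<cdot>\<^bsub>C\<^esub> f)]"
      using gz_class_eq[OF subsetD[OF zigzag_step_equiv]] by simp
    then show "on_Arr (gz_functor C S) (g \<cdot>\<^bsub>C\<^esub> f) =
        on_Arr (gz_functor C S) g \<cdot>\<^bsub>gz_localisation C S\<^esub> on_Arr (gz_functor C S) f"
      using fg gf gz_comp_class[OF assms z[OF fg(1)] z[OF fg(2)]]
      by (simp add: gz_functor_def gz_localisation_def Mor_def)
  next
    fix f X Y assume f: "f \<in> Mor C X Y"
    then show "on_Arr (gz_functor C S) f
        \<in> Mor (gz_localisation C S) (on_Obj (gz_functor C S) X) (on_Obj (gz_functor C S) Y)"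
      unfolding gz_Mor using z[OF f] by (simp add: gz_functor_def Mor_def)
  qed (simp add: gz_functor_def gz_localisation_def)
qed

lemma gz_functor_inverts:
  assumes "category C" "S \<subseteq> Arr C" "s \<in> S"
  shows "iso_arrow (gz_localisation C S) (on_Arr (gz_functor C S) s)"
proof -
  interpret category C by fact
  let ?X = "Dom C s" and ?Y = "Cod C s"
  have O: "?X \<in> Obj C" "?Y \<in> Obj C" using assms Dom_Obj Cod_Obj by auto
  have z: "[Fwd s] \<in> zigzags C S ?X ?Y" "[Bwd s] \<in> zigzags C S ?Y ?X"
    using assms O by (auto simp: zigzags_def)
  have "([] @ [Fwd s, Bwd s] @ [], [] @ [] @ []) \<in> zigzag_step C S ?X ?X"
    using assms O by - (rule zigzag_stepI, rule rule_inv_left, auto simp: zigzags_def)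
  then have 1: "gz_class C S ?X ?X [Fwd s, Bwd s] = gz_class C S ?X ?X []"
    using gz_class_eq[OF subsetD[OF zigzag_step_equiv]] by simp
  have "([] @ [Bwd s, Fwd s] @ [], [] @ [] @ []) \<in> zigzag_step C S ?Y ?Y"
    using assms O by - (rule zigzag_stepI, rule rule_inv_right, auto simp: zigzags_def)
  then have 2: "gz_class C S ?Y ?Y [Bwd s, Fwd s] = gz_class C S ?Y ?Y []"
    using gz_class_eq[OF subsetD[OF zigzag_step_equiv]] by simp
  have m: "gz_class C S ?X ?Y [Fwd s] \<in> Mor (gz_localisation C S) ?X ?Y"
    "gz_class C S ?Y ?X [Bwd s] \<in> Mor (gz_localisation C S) ?Y ?X"
    using z by (auto simp: gz_Mor)
  show ?thesis
    unfolding iso_arrow_def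
    using m 1 2 gz_comp_class[OF assms(1,2) z] gz_comp_class[OF assms(1,2) z(2) z(1)]
    by (auto simp: gz_functor_def Mor_def gz_localisation_def intro!: bexI[OF _ m(2)])
qed

definition inv_arrow :: "('o, 'm, 'x) cat_scheme \<Rightarrow> 'm \<Rightarrow> 'm" where
  "inv_arrow C f = (SOME g. g \<in> Mor C (Cod C f) (Dom C f) \<and>
     g \<cdot>\<^bsub>C\<^esub> f = Ident C (Dom C f) \<and> f \<cdot>\<^bsub>C\<^esub> g = Ident C (Cod C f))"

lemma inv_arrow:
  assumes "iso_arrow C f" "f \<in> Mor C X Y"
  shows "inv_arrow C f \<in> Mor C Y X" "inv_arrow C f \<cdot>\<^bsub>C\<^esub> f = Ident C X"
    "f \<cdot>\<^bsub>C\<^esub> inv_arrow C f = Ident C Y"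
proof -
  have d: "Dom C f = X" "Cod C f = Y" using assms(2) by (auto simp: Mor_def)
  have "\<exists>g. g \<in> Mor C (Cod C f) (Dom C f) \<and>
     g \<cdot>\<^bsub>C\<^esub> f = Ident C (Dom C f) \<and> f \<cdot>\<^bsub>C\<^esub> g = Ident C (Cod C f)"
    using assms(1) by (auto simp: iso_arrow_def)
  from someI_ex[OF this, folded inv_arrow_def]
  show "inv_arrow C f \<in> Mor C Y X" "inv_arrow C f \<cdot>\<^bsub>C\<^esub> f = Ident C X"
    "f \<cdot>\<^bsub>C\<^esub> inv_arrow C f = Ident C Y" by (simp_all add: d)
qed

lemma (in category) inv_arrow_unique:
  assumes "f \<in> Mor C X Y" "g \<in> Mor C Y X" "h \<in> Mor C Y X"
    and "g \<cdot> f = Ident C X" "f \<cdot> h = Ident C Y"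
  shows "g = h"
  using Comp_assoc[OF assms(3,1,2)] Comp_Ident[OF assms(2)] Ident_Comp[OF assms(3)] assms(4,5)
  by simp

fun zigzag_eval ::
  "('o, 'm, 'x) cat_scheme \<Rightarrow> ('p, 'n, 'y) cat_scheme \<Rightarrow> ('o, 'm, 'p, 'n, 'z) funct_scheme
    \<Rightarrow> 'o \<Rightarrow> 'm step list \<Rightarrow> 'n" where
  "zigzag_eval C B F X [] = Ident B (on_Obj F X)"
| "zigzag_eval C B F X (Fwd f # as) = zigzag_eval C B F (Cod C f) as \<cdot>\<^bsub>B\<^esub> on_Arr F f"
| "zigzag_eval C B F X (Bwd s # as) =
     zigzag_eval C B F (Dom C s) as \<cdot>\<^bsub>B\<^esub> inv_arrow B (on_Arr F s)"

locale inverting_functor = cat_functor C B F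
  for C :: "('o, 'm, 'x) cat_scheme" (structure)
    and B :: "('p, 'n, 'y) cat_scheme" (structure)
    and F :: "('o, 'm, 'p, 'n, 'z) funct_scheme" +
  fixes S :: "'m set"
  assumes S_Arr: "S \<subseteq> Arr C"
    and inverts: "s \<in> S \<Longrightarrow> iso_arrow B (on_Arr F s)"
begin

lemma S_Mor: "s \<in> S \<Longrightarrow> on_Arr F s \<in> Mor B (on_Obj F (Dom C s)) (on_Obj F (Cod C s))"
  using S_Arr by (intro on_Arr) (auto simp: Mor_def)

lemmas inv_S = inv_arrow[OF inverts S_Mor]

lemma zigzag_eval_Mor:
  "is_zigzag C S X as Y \<Longrightarrow> zigzag_eval C B F X as \<in> Mor B (on_Obj F X) (on_Obj F Y)"
proof (induction as arbitrary: X)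
  case Nil
  then show ?case by (auto intro: B.Ident_Mor on_Obj)
next
  case (Cons a as)
  show ?case
  proof (cases a)
    case (Fwd f)
    then have "on_Arr F f \<in> Mor B (on_Obj F X) (on_Obj F (Cod C f))"
      using Cons.prems by (intro on_Arr) (auto simp: Mor_def)
    then show ?thesis using Cons Fwd by (auto intro: B.Comp_Mor)
  next
    case (Bwd s)
    then show ?thesis using Cons inv_S(1)[of s] by (auto intro: B.Comp_Mor)
  qed
qed

lemma zigzag_eval_append:
  assumes "is_zigzag C S X as Y" "is_zigzag C S Y bs Z"
  shows "zigzag_eval C B F X (as @ bs) = zigzag_eval C B F Y bs \<cdot>\<^bsub>B\<^esub> zigzag_eval C B F X as"
  using assms(1)
proof (induction as arbitrary: X)
  case Nil
  then show ?case using B.Comp_Ident[OF zigzag_eval_Mor[OF assms(2)]] by auto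
next
  case (Cons a as)
  note bs = zigzag_eval_Mor[OF assms(2)]
  show ?case
  proof (cases a)
    case (Fwd f)
    then have "on_Arr F f \<in> Mor B (on_Obj F X) (on_Obj F (Cod C f))"
      using Cons.prems by (intro on_Arr) (auto simp: Mor_def)
    then show ?thesis
      using Cons Fwd B.Comp_assoc[OF _ zigzag_eval_Mor[of "Cod C f" as Y] bs] by auto
  next
    case (Bwd s)
    then show ?thesis
      using Cons B.Comp_assoc[OF inv_S(1) zigzag_eval_Mor[of "Dom C s" as Y] bs] by auto
  qed
qed

lemma zigzag_eval_rule:
  assumes "zigzag_rule C S l r" "is_zigzag C S X l Y" "is_zigzag C S X r Y"
  shows "zigzag_eval C B F X l = zigzag_eval C B F X r"
  using assms(1)
proof cases
  case (rule_ident X')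
  then have "X' = X" "X \<in> Obj C" using assms(2,3) A.Ident_Mor[of X'] by (auto simp: Mor_def)
  then show ?thesis
    using rule_ident on_Ident A.Ident_Mor[of X] B.Ident_Comp[OF B.Ident_Mor[OF on_Obj]]
    by (auto simp: Mor_def)
next
  case (rule_comp f g)
  then have m: "f \<in> Mor C X (Dom C g)" "g \<in> Mor C (Dom C g) (Cod C g)"
    using assms(2) by (auto simp: Mor_def)
  have "g \<cdot>\<^bsub>C\<^esub> f \<in> Mor C X (Cod C g)" using m by (rule A.Comp_Mor)
  then have "Cod C (g \<cdot>\<^bsub>C\<^esub> f) = Cod C g" by (simp add: Mor_def)
  then show ?thesis
    using rule_comp m on_Comp[OF m] B.Ident_Comp[OF on_Arr[OF m(2)]]
      B.Ident_Comp[OF B.Comp_Mor[OF on_Arr[OF m(1)] on_Arr[OF m(2)]]]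
    by simp
next
  case (rule_inv_left s)
  then show ?thesis
    using assms(2) inv_S[of s] B.Ident_Comp[OF inv_S(1)[of s]] by auto
next
  case (rule_inv_right s)
  then show ?thesis
    using assms(2) inv_S[of s] B.Ident_Comp[OF S_Mor[of s]] by auto
qed

lemma zigzag_eval_step:
  assumes "(as, bs) \<in> zigzag_step C S X Y"
  shows "zigzag_eval C B F X as = zigzag_eval C B F X bs"
proof -
  note app = zigzag_append[OF A.category_axioms S_Arr]
  obtain us l r vs where *: "as = us @ l @ vs" "bs = us @ r @ vs" "zigzag_rule C S l r"
      "is_zigzag C S X as Y" "is_zigzag C S X bs Y"
    using assms unfolding zigzag_step_def zigzags_def by blast
  from *(1,4) obtain P Q where 1: "is_zigzag C S X us P" "is_zigzag C S P l Q" "is_zigzag C S Q vs Y"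
    by (auto simp: app)
  from *(2,5) obtain P' Q' where 2: "is_zigzag C S X us P'" "is_zigzag C S P' r Q'"
      "is_zigzag C S Q' vs Y"
    by (auto simp: app)
  have eP: "P = P'"
    using 1(1) 2(1) by (induction us arbitrary: X) auto
  have end_unique: "Z = Z'" if "is_zigzag C S W cs Z" "is_zigzag C S W cs Z'" for W cs Z Z'
    using that by (induction cs arbitrary: W) auto
  have eQ: "Q = Q'"
    using *(3)
  proof cases
    case (rule_comp f g)
    then have "g \<cdot>\<^bsub>C\<^esub> f \<in> Mor C (Dom C f) (Cod C g)"
      by (intro A.Comp_Mor) (auto simp: Mor_def)
    then show ?thesis using 1(2) 2(2) rule_comp by (auto simp: Mor_def)
  qed (use 1(2) 2(2) eP A.Ident_Mor in \<open>auto simp: Mor_def\<close>)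
  have "zigzag_eval C B F P l = zigzag_eval C B F P r"
    using zigzag_eval_rule[OF *(3) 1(2)] 2(2) eP eQ by simp
  moreover have "is_zigzag C S P (l @ vs) Y" "is_zigzag C S P (r @ vs) Y"
    using 1 2 eP eQ by (auto simp: app)
  ultimately show ?thesis
    using 1 2 eP eQ *(1,2)
      zigzag_eval_append[of X us P] zigzag_eval_append[of P l Q vs Y]
      zigzag_eval_append[of P r Q vs Y]
    by simp
qed

lemma zigzag_eval_equiv:
  assumes "(as, bs) \<in> zigzag_equiv C S X Y"
  shows "zigzag_eval C B F X as = zigzag_eval C B F X bs"
proof -
  have "(as, bs) \<in> (zigzag_step C S X Y \<union> (zigzag_step C S X Y)\<inverse>)\<^sup>*"
    using assms by (simp add: zigzag_equiv_def)
  then show ?thesis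
  proof induction
    case (step cs ds)
    from step.hyps(2) have "zigzag_eval C B F X cs = zigzag_eval C B F X ds"
      using zigzag_eval_step[of cs ds X Y] zigzag_eval_step[of ds cs X Y] by auto
    with step.IH show ?case by simp
  qed simp
qed

definition gz_lift :: "('o, ('o, 'm) gz_arrow, 'p, 'n) funct" where
  "gz_lift = \<lparr>on_Obj = on_Obj F, on_Arr = (\<lambda>(X, Y, A). zigzag_eval C B F X (SOME as. as \<in> A))\<rparr>"

lemma gz_lift_class:
  assumes "as \<in> zigzags C S X Y"
  shows "on_Arr gz_lift (gz_class C S X Y as) = zigzag_eval C B F X as"
proof -
  have "as \<in> zigzag_equiv C S X Y `` {as}"
    by (rule equiv_class_self[OF zigzag_equiv_equiv assms])
  then have "(as, SOME bs. bs \<in> zigzag_equiv C S X Y `` {as}) \<in> zigzag_equiv C S X Y"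
    by (metis Image_singleton_iff someI_ex)
  then show ?thesis
    using zigzag_eval_equiv by (simp add: gz_lift_def gz_class_def)
qed

lemma gz_lift_functor: "cat_functor (gz_localisation C S) B gz_lift"
proof (intro cat_functor.intro cat_functor_axioms.intro category_gz A.category_axioms S_Arr
    B.category_axioms)
  fix X assume X: "X \<in> Obj (gz_localisation C S)"
  then show "on_Obj gz_lift X \<in> Obj B"
    by (simp add: gz_lift_def gz_localisation_def on_Obj)
  have "[] \<in> zigzags C S X X" using X by (simp add: zigzags_def gz_localisation_def)
  then show "on_Arr gz_lift (Ident (gz_localisation C S) X) = Ident B (on_Obj gz_lift X)"
    using gz_lift_class[of "[]" X X] by (simp add: gz_lift_def gz_localisation_def)
next
  fix f X Y assume "f \<in> Mor (gz_localisation C S) X Y"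
  then obtain as where "as \<in> zigzags C S X Y" "f = gz_class C S X Y as" by (auto simp: gz_Mor)
  then show "on_Arr gz_lift f \<in> Mor B (on_Obj gz_lift X) (on_Obj gz_lift Y)"
    using gz_lift_class[of as X Y] zigzag_eval_Mor[of X as Y]
    by (simp add: gz_lift_def zigzags_def)
next
  fix f g X Y Z
  assume "f \<in> Mor (gz_localisation C S) X Y" "g \<in> Mor (gz_localisation C S) Y Z"
  then obtain as bs where *: "as \<in> zigzags C S X Y" "f = gz_class C S X Y as"
      "bs \<in> zigzags C S Y Z" "g = gz_class C S Y Z bs"
    by (auto simp: gz_Mor)
  have "g \<cdot>\<^bsub>gz_localisation C S\<^esub> f = gz_class C S X Z (as @ bs)"
    using gz_comp_class[OF A.category_axioms S_Arr *(1,3)] *(2,4) by (simp add: gz_localisation_def)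
  then show "on_Arr gz_lift (g \<cdot>\<^bsub>gz_localisation C S\<^esub> f) = on_Arr gz_lift g \<cdot>\<^bsub>B\<^esub> on_Arr gz_lift f"
    using * gz_lift_class zigzags_append[OF A.category_axioms S_Arr *(1,3)]
      zigzag_eval_append[of X as Y bs Z]
    by (simp add: zigzags_def)
qed

lemma gz_lift_factors:
  "X \<in> Obj C \<Longrightarrow> on_Obj gz_lift (on_Obj (gz_functor C S) X) = on_Obj F X"
  "f \<in> Arr C \<Longrightarrow> on_Arr gz_lift (on_Arr (gz_functor C S) f) = on_Arr F f"
proof -
  show "X \<in> Obj C \<Longrightarrow> on_Obj gz_lift (on_Obj (gz_functor C S) X) = on_Obj F X"
    by (simp add: gz_lift_def gz_functor_def)
  assume f: "f \<in> Arr C"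
  then have "[Fwd f] \<in> zigzags C S (Dom C f) (Cod C f)" "f \<in> Mor C (Dom C f) (Cod C f)"
    by (auto simp: zigzags_def A.Cod_Obj Mor_def)
  then show "on_Arr gz_lift (on_Arr (gz_functor C S) f) = on_Arr F f"
    using gz_lift_class B.Ident_Comp[OF on_Arr] by (simp add: gz_functor_def)
qed

lemma gz_lift_unique:
  fixes H :: "('o, ('o, 'm) gz_arrow, 'p, 'n) funct"
  assumes H: "cat_functor (gz_localisation C S) B H"
    and H_Obj: "\<And>X. X \<in> Obj C \<Longrightarrow> on_Obj H (on_Obj (gz_functor C S) X) = on_Obj F X"
    and H_Arr: "\<And>f. f \<in> Arr C \<Longrightarrow> on_Arr H (on_Arr (gz_functor C S) f) = on_Arr F f"
    and "\<alpha> \<in> Arr (gz_localisation C S)"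
  shows "on_Arr H \<alpha> = on_Arr gz_lift \<alpha>"
proof -
  interpret H: cat_functor "gz_localisation C S" B H by fact
  note comp = gz_comp_class[OF A.category_axioms S_Arr]
  have [simp]: "Comp (gz_localisation C S) = gz_comp C S" by (simp add: gz_localisation_def)
  have Ob: "on_Obj H X = on_Obj F X" if "X \<in> Obj C" for X
    using H_Obj[OF that] by (simp add: gz_functor_def)
  have Fw: "on_Arr H (gz_class C S (Dom C f) (Cod C f) [Fwd f]) = on_Arr F f" if "f \<in> Arr C" for f
    using H_Arr[OF that] by (simp add: gz_functor_def)
  have Bw: "on_Arr H (gz_class C S (Cod C s) (Dom C s) [Bwd s]) = inv_arrow B (on_Arr F s)"
    if s: "s \<in> S" for s
  proof -
    let ?X = "Dom C s" and ?Y = "Cod C s"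
    have sA: "s \<in> Arr C" using s S_Arr by auto
    have O: "?X \<in> Obj C" "?Y \<in> Obj C" using sA A.Dom_Obj A.Cod_Obj by auto
    have z: "[Bwd s] \<in> zigzags C S ?Y ?X" "[Fwd s] \<in> zigzags C S ?X ?Y"
      using s sA O by (auto simp: zigzags_def)
    have n: "[] \<in> zigzags C S ?X ?X" using O by (simp add: zigzags_def)
    let ?b = "gz_class C S ?Y ?X [Bwd s]" and ?f = "gz_class C S ?X ?Y [Fwd s]"
    have m: "?b \<in> Mor (gz_localisation C S) ?Y ?X" "?f \<in> Mor (gz_localisation C S) ?X ?Y"
      using z by (auto simp: gz_Mor)
    have "([] @ [Fwd s, Bwd s] @ [], [] @ [] @ []) \<in> zigzag_step C S ?X ?X"
      using s sA O by - (rule zigzag_stepI, rule rule_inv_left, auto simp: zigzags_def)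
    then have "gz_class C S ?X ?X [Fwd s, Bwd s] = gz_class C S ?X ?X []"
      using gz_class_eq[OF subsetD[OF zigzag_step_equiv]] by simp
    then have "?b \<cdot>\<^bsub>gz_localisation C S\<^esub> ?f = Ident (gz_localisation C S) ?X"
      using comp[OF z(2,1)] by (simp add: gz_localisation_def)
    then have "on_Arr H ?b \<cdot>\<^bsub>B\<^esub> on_Arr F s = Ident B (on_Obj F ?X)"
      using H.on_Comp[OF m(2,1)] H.on_Ident[of ?X] Fw[OF sA] Ob O
      by (simp add: gz_localisation_def)
    moreover have "on_Arr H ?b \<in> Mor B (on_Obj F ?Y) (on_Obj F ?X)"
      using H.on_Arr[OF m(1)] Ob O by simp
    ultimately show ?thesis
      using B.inv_arrow_unique[OF S_Mor[OF s] _ inv_S(1)[OF s s]] inv_S(3)[OF s s] by blast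
  qed
  have main: "on_Arr H (gz_class C S X Y as) = zigzag_eval C B F X as"
    if "is_zigzag C S X as Y" for X Y as
    using that
  proof (induction as arbitrary: X)
    case Nil
    then show ?case
      using H.on_Ident[of X] Ob by (auto simp: gz_localisation_def)
  next
    case (Cons a as)
    let ?P = "step_tgt C a"
    have z: "is_zigzag C S X [a] ?P" "is_zigzag C S ?P as Y"
      using Cons.prems zigzag_Obj[OF A.category_axioms S_Arr, of ?P as Y] by auto
    have "on_Arr H (gz_class C S X Y (a # as))
        = on_Arr H (gz_class C S ?P Y as) \<cdot>\<^bsub>B\<^esub> on_Arr H (gz_class C S X ?P [a])"
      using comp[of "[a]" X ?P as Y] z
        H.on_Comp[of "gz_class C S X ?P [a]" X ?P "gz_class C S ?P Y as" Y]
      by (auto simp: zigzags_def gz_Mor)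
    then show ?case
      using Cons z Fw Bw by (cases a) auto
  qed
  have "\<alpha> \<in> Mor (gz_localisation C S) (fst \<alpha>) (fst (snd \<alpha>))"
    using assms(4) by (auto simp: Mor_def gz_localisation_def)
  then obtain as where "as \<in> zigzags C S (fst \<alpha>) (fst (snd \<alpha>))"
      "\<alpha> = gz_class C S (fst \<alpha>) (fst (snd \<alpha>)) as"
    unfolding gz_Mor by blast
  then show ?thesis
    using main gz_lift_class by (metis mem_Collect_eq zigzags_def)
qed

end


section \<open>Degeneration data\<close>

text \<open>For a degeneration data \<open>D\<close> of \<open>C\<close>: \<open>CatK D\<close> and \<open>CatV D\<close> are the two ambient
  triangulated categories, \<open>SubV D\<close> is the class of objects of the full subcategory
  \<open>CatV0 D\<close> of \<open>CatV D\<close>, \<open>EmbK D\<close> embeds \<open>C\<close> into \<open>CatK D\<close>, \<open>Up D\<close> goes from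
  \<open>CatK D\<close> to \<open>CatV D\<close>, and \<open>Phi D\<close> from \<open>CatV0 D\<close> to \<open>CatK D\<close>.\<close>

record ('o, 'm, 'ok, 'mk, 'ov, 'mv) degen_data =
  CatK :: "('ok, 'mk) tricat"
  EmbK :: "('o, 'm, 'ok, 'mk) trifunct"
  CatV :: "('ov, 'mv) tricat"
  SubV :: "'ov set"
  Up :: "('ok, 'mk, 'ov, 'mv) trifunct"
  Phi :: "('ov, 'mv, 'ok, 'mk) trifunct"
  tee :: "'ov \<Rightarrow> 'mv"

definition CatV0 :: "('o, 'm, 'ok, 'mk, 'ov, 'mv) degen_data \<Rightarrow> ('ov, 'mv) tricat" where
  "CatV0 D = full_sub (CatV D) (SubV D)"

definition up_obj :: "('o, 'm, 'ok, 'mk, 'ov, 'mv) degen_data \<Rightarrow> 'o \<Rightarrow> 'ov" where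
  "up_obj D M = on_Obj (Up D) (on_Obj (EmbK D) M)"

locale degeneration_data =
  fixes C :: "('o, 'm) tricat"
    and D :: "('o, 'm, 'ok, 'mk, 'ov, 'mv) degen_data"
  assumes CatK_triangulated: "triangulated_category (CatK D)"
    and CatK_split: "split_idempotents (CatK D)"
    and EmbK_triangulated: "triangulated_functor C (CatK D) (EmbK D)"
    and EmbK_fully_faithful: "fully_faithful C (CatK D) (EmbK D)"
    and CatV_triangulated: "triangulated_category (CatV D)"
    and CatV_split: "split_idempotents (CatV D)"
    and SubV_sub: "full_triangulated_sub (CatV D) (SubV D)"
    and Up_triangulated: "triangulated_functor (CatK D) (CatV D) (Up D)"
    and Phi_triangulated: "triangulated_functor (CatV0 D) (CatK D) (Phi D)"
    and Up_SubV: "M \<in> Obj C \<Longrightarrow> up_obj D M \<in> SubV D"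
    and tee_natural: "tri_nat_endo_id (CatV D) (tee D)"
    and Phi_tee_split_mono: "M \<in> Obj C
      \<Longrightarrow> split_mono (CatK D) (on_Arr (Phi D) (tee D (up_obj D M)))"
    and Phi_tee_cone: "M \<in> Obj C
      \<Longrightarrow> isomorphic (CatK D) (cone (CatK D) (on_Arr (Phi D) (tee D (up_obj D M))))
            (on_Obj (EmbK D) M)"

definition tee_arrows :: "('o, 'm, 'ok, 'mk, 'ov, 'mv) degen_data \<Rightarrow> 'mv set" where
  "tee_arrows D = tee D ` SubV D"

text \<open>Types cannot be quantified over inside a formula, so the object and arrow types of the
  two ambient categories are parameters of the relation. It is used polymorphically in them.\<close>

definition cdeg_le ::
  "('ok \<times> 'mk) itself \<Rightarrow> ('ov \<times> 'mv) itself \<Rightarrow> ('o, 'm) tricat \<Rightarrow> 'o \<Rightarrow> 'o \<Rightarrow> bool" where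
  "cdeg_le (_ :: ('ok \<times> 'mk) itself) (_ :: ('ov \<times> 'mv) itself) C M N \<longleftrightarrow>
     M \<in> Obj C \<and> N \<in> Obj C \<and>
     (\<exists>(D :: ('o, 'm, 'ok, 'mk, 'ov, 'mv) degen_data) Q.
        degeneration_data C D \<and> Q \<in> SubV D \<and>
        isomorphic (gz_localisation (CatV0 D) (tee_arrows D))
          (on_Obj (gz_functor (CatV0 D) (tee_arrows D)) Q)
          (on_Obj (gz_functor (CatV0 D) (tee_arrows D)) (up_obj D M)) \<and>
        isomorphic (CatK D) (on_Obj (Phi D) (cone (CatV0 D) (tee D Q))) (on_Obj (EmbK D) N))"

end

theory Submission
  imports Defs
begin

text \<open>The equivalence holds with the same degeneration data and the same object \<open>Q\<close> on both
  sides, for three reasons.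

  \<^item> The defining condition of the degeneration says that \<open>Q\<close> becomes a zero object once \<open>t\<close> is
    inverted, because \<open>0\<up>\<close> is a zero object. An object \<open>Q\<close> vanishes after inverting a
    central endomorphism exactly when \<open>t\<close> acts nilpotently on it
    (\<open>zero_in_localisation_iff_nilpotent\<close>): one direction because a power of \<open>t\<close> that is zero
    becomes an isomorphism through a zero object, the other because clearing denominators in a
    zigzag that represents the identity and passes through a zero object gives \<open>t ^ n = 0\<close>.

  \<^item> A triangulated functor commutes with cones up to isomorphism, since cones are unique
    (\<open>cone_unique\<close>, \<open>cone_on_Arr\<close>).

  \<^item> If \<open>f : W \<rightarrow> W\<close> is nilpotent and the cone of \<open>f\<close> lies in the essential image of a
    triangulated embedding of a category with split idempotents, then so does \<open>W\<close>
    (\<open>ess_image_nilpotent\<close>). By the octahedral axiom the cone of \<open>f ^ n\<close> is an iterated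
    extension of copies of the cone of \<open>f\<close>, hence lies in the essential image; for \<open>f ^ n = 0\<close>
    it contains \<open>W\<close> as a retract. With \<open>f = \<Phi>(t\<^sub>Q)\<close>, whose cone is \<open>N\<close>, this puts \<open>\<Phi>(Q)\<close>
    in the given subcategory.\<close>

section \<open>Isomorphic objects\<close>

context category
begin

lemma Mor_Obj: "f \<in> Mor C X Y \<Longrightarrow> X \<in> Obj C" "f \<in> Mor C X Y \<Longrightarrow> Y \<in> Obj C"
  using Dom_Obj Cod_Obj by (auto simp: Mor_def)

lemma isomorphicI:
  assumes "f \<in> Mor C X Y" "g \<in> Mor C Y X" "g \<cdot> f = Ident C X" "f \<cdot> g = Ident C Y"
  shows "isomorphic C X Y"
proof -
  have "iso_arrow C f"
    using assms by (auto simp: iso_arrow_def Mor_def)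
  then show ?thesis
    using assms(1) Mor_Obj[OF assms(1)] by (auto simp: isomorphic_def)
qed

lemma isomorphicI_left_right:
  assumes "f \<in> Mor C X Y" "g \<in> Mor C Y X" "h \<in> Mor C Y X"
    and "g \<cdot> f = Ident C X" "f \<cdot> h = Ident C Y"
  shows "isomorphic C X Y"
  using isomorphicI[OF assms(1,2,4)] inv_arrow_unique[OF assms] assms(5) by simp

lemma isomorphicE:
  assumes "isomorphic C X Y"
  obtains f g where "f \<in> Mor C X Y" "g \<in> Mor C Y X" "g \<cdot> f = Ident C X" "f \<cdot> g = Ident C Y"
    "iso_arrow C f"
  using assms unfolding isomorphic_def iso_arrow_def Mor_def by auto

lemma iso_arrowI:
  assumes "f \<in> Mor C X Y" "g \<in> Mor C Y X" "g \<cdot> f = Ident C X" "f \<cdot> g = Ident C Y"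
  shows "iso_arrow C f"
  using assms by (auto simp: iso_arrow_def Mor_def)

lemma isomorphic_refl: "X \<in> Obj C \<Longrightarrow> isomorphic C X X"
  using isomorphicI[OF Ident_Mor Ident_Mor] Comp_Ident[OF Ident_Mor] by simp

lemma isomorphic_sym: "isomorphic C X Y \<Longrightarrow> isomorphic C Y X"
  by (metis isomorphicE isomorphicI)

lemma comp_cancel_middle:
  assumes "f \<in> Mor C X Y" "g \<in> Mor C Y Z" "g' \<in> Mor C Z Y" "f' \<in> Mor C Y W"
    and "g' \<cdot> g = Ident C Y"
  shows "(f' \<cdot> g') \<cdot> (g \<cdot> f) = f' \<cdot> f"
proof -
  have "(f' \<cdot> g') \<cdot> (g \<cdot> f) = f' \<cdot> ((g' \<cdot> g) \<cdot> f)"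
    using Comp_assoc[OF Comp_Mor[OF assms(1,2)] assms(3,4)] Comp_assoc[OF assms(1-3)] by simp
  then show ?thesis
    using assms Ident_Comp by simp
qed

lemma isomorphic_trans:
  assumes "isomorphic C X Y" "isomorphic C Y Z"
  shows "isomorphic C X Z"
proof -
  obtain f f' where f: "f \<in> Mor C X Y" "f' \<in> Mor C Y X" "f' \<cdot> f = Ident C X" "f \<cdot> f' = Ident C Y"
    using assms(1) by (rule isomorphicE)
  obtain g g' where g: "g \<in> Mor C Y Z" "g' \<in> Mor C Z Y" "g' \<cdot> g = Ident C Y" "g \<cdot> g' = Ident C Z"
    using assms(2) by (rule isomorphicE)
  show ?thesis
    by (rule isomorphicI[of "g \<cdot> f" _ _ "f' \<cdot> g'"])
      (use f g Comp_Mor comp_cancel_middle in auto)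
qed

lemma Pow_arr_Mor: "f \<in> Mor C X X \<Longrightarrow> Pow_arr C X f n \<in> Mor C X X"
  by (induction n) (use Ident_Mor Mor_Obj Comp_Mor in auto)

lemma Pow_arr_iso:
  assumes "f \<in> Mor C X X" "iso_arrow C f"
  shows "iso_arrow C (Pow_arr C X f n)"
proof -
  obtain g where g: "g \<in> Mor C X X" "g \<cdot> f = Ident C X" "f \<cdot> g = Ident C X"
    using inv_arrow[OF assms(2,1)] by blast
  have "\<exists>h \<in> Mor C X X. h \<cdot> Pow_arr C X f n = Ident C X \<and> Pow_arr C X f n \<cdot> h = Ident C X"
  proof (induction n)
    case 0
    have "Ident C X \<in> Mor C X X"
      using assms(1) Mor_Obj Ident_Mor by blast
    then show ?case
      using Comp_Ident by auto
  next
    case (Suc n)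
    then obtain h where h: "h \<in> Mor C X X" "h \<cdot> Pow_arr C X f n = Ident C X"
        "Pow_arr C X f n \<cdot> h = Ident C X"
      by blast
    note P = Pow_arr_Mor[OF assms(1), of n]
    have "(h \<cdot> g) \<cdot> (f \<cdot> Pow_arr C X f n) = Ident C X" "(f \<cdot> Pow_arr C X f n) \<cdot> (h \<cdot> g) = Ident C X"
      using comp_cancel_middle[OF P assms(1) g(1) h(1) g(2)]
        comp_cancel_middle[OF g(1) h(1) P assms(1) h(3)] h(2) g(3) by simp_all
    then show ?case
      using Comp_Mor[OF g(1) h(1)] by auto
  qed
  then show ?thesis
    using Pow_arr_Mor[OF assms(1)] iso_arrowI by blast
qed

end


lemma (in cat_functor) isomorphic_on_Obj:
  assumes "isomorphic A X Y"
  shows "isomorphic B (on_Obj F X) (on_Obj F Y)"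
proof -
  obtain f g where f: "f \<in> Mor A X Y" "g \<in> Mor A Y X" "g \<cdot> f = Ident A X" "f \<cdot> g = Ident A Y"
    using assms by (rule A.isomorphicE)
  have "on_Arr F g \<cdot>\<^bsub>B\<^esub> on_Arr F f = Ident B (on_Obj F X)"
    "on_Arr F f \<cdot>\<^bsub>B\<^esub> on_Arr F g = Ident B (on_Obj F Y)"
    using on_Comp[OF f(1,2)] on_Comp[OF f(2,1)] f(3,4) on_Ident A.Mor_Obj[OF f(1)] by simp_all
  then show ?thesis
    using B.isomorphicI on_Arr f(1,2) by blast
qed

lemma (in cat_functor) on_Pow_arr:
  assumes "f \<in> Mor A X X"
  shows "on_Arr F (Pow_arr A X f n) = Pow_arr B (on_Obj F X) (on_Arr F f) n"
  using on_Ident on_Comp[OF A.Pow_arr_Mor assms] assms A.Mor_Obj by (induction n) auto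

lemma (in cat_functor) fully_faithful_full:
  assumes "fully_faithful A B F" "X \<in> Obj A" "Y \<in> Obj A" "g \<in> Mor B (on_Obj F X) (on_Obj F Y)"
  obtains f where "f \<in> Mor A X Y" "on_Arr F f = g"
proof -
  have "g \<in> on_Arr F ` Mor A X Y"
    using assms unfolding fully_faithful_def bij_betw_def by simp
  then show ?thesis using that by blast
qed

lemma (in cat_functor) fully_faithful_faithful:
  assumes "fully_faithful A B F" "f \<in> Mor A X Y" "g \<in> Mor A X Y" "on_Arr F f = on_Arr F g"
  shows "f = g"
  using assms A.Mor_Obj[OF assms(2)] unfolding fully_faithful_def bij_betw_def inj_on_def by blast

lemma (in cat_functor) fully_faithful_reflects_isomorphic:
  assumes ff: "fully_faithful A B F" and O: "X \<in> Obj A" "Y \<in> Obj A"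
    and iso: "isomorphic B (on_Obj F X) (on_Obj F Y)"
  shows "isomorphic A X Y"
proof -
  obtain u v where u: "u \<in> Mor B (on_Obj F X) (on_Obj F Y)" "v \<in> Mor B (on_Obj F Y) (on_Obj F X)"
      "v \<cdot>\<^bsub>B\<^esub> u = Ident B (on_Obj F X)" "u \<cdot>\<^bsub>B\<^esub> v = Ident B (on_Obj F Y)"
    using iso by (rule B.isomorphicE)
  obtain f where f: "f \<in> Mor A X Y" "on_Arr F f = u"
    using fully_faithful_full[OF ff O u(1)] by blast
  obtain g where g: "g \<in> Mor A Y X" "on_Arr F g = v"
    using fully_faithful_full[OF ff O(2,1) u(2)] by blast
  show ?thesis
  proof (rule A.isomorphicI[OF f(1) g(1)])
    show "g \<cdot> f = Ident A X"
      by (rule fully_faithful_faithful[OF ff A.Comp_Mor[OF f(1) g(1)] A.Ident_Mor[OF O(1)]])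
        (use on_Comp[OF f(1) g(1)] on_Ident O f g u in simp)
    show "f \<cdot> g = Ident A Y"
      by (rule fully_faithful_faithful[OF ff A.Comp_Mor[OF g(1) f(1)] A.Ident_Mor[OF O(2)]])
        (use on_Comp[OF g(1) f(1)] on_Ident O f g u in simp)
  qed
qed


section \<open>Zero arrows and unipotent endomorphisms\<close>

context additive_category
begin

lemma Zero_Mor:
  assumes "X \<in> Obj C" "Y \<in> Obj C"
  shows "Zero C X Y \<in> Mor C X Y"
proof -
  interpret G: comm_group "hom_group C X Y"
    using assms hom_comm_group by blast
  show ?thesis using G.one_closed by (simp add: hom_group_def)
qed

lemma Plus_Mor:
  assumes "f \<in> Mor C X Y" "g \<in> Mor C X Y"
  shows "Plus C f g \<in> Mor C X Y"
proof -
  interpret G: comm_group "hom_group C X Y"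
    using assms(1) Mor_Obj hom_comm_group by blast
  show ?thesis using G.m_closed assms by (simp add: hom_group_def)
qed

lemma Plus_assoc:
  assumes "f \<in> Mor C X Y" "g \<in> Mor C X Y" "h \<in> Mor C X Y"
  shows "Plus C (Plus C f g) h = Plus C f (Plus C g h)"
proof -
  interpret G: comm_group "hom_group C X Y"
    using assms(1) Mor_Obj hom_comm_group by blast
  show ?thesis using G.m_assoc assms by (simp add: hom_group_def)
qed

lemma Plus_comm:
  assumes "f \<in> Mor C X Y" "g \<in> Mor C X Y"
  shows "Plus C f g = Plus C g f"
proof -
  interpret G: comm_group "hom_group C X Y"
    using assms(1) Mor_Obj hom_comm_group by blast
  show ?thesis using G.m_comm assms by (simp add: hom_group_def)
qed

lemma Plus_Zero:
  assumes "f \<in> Mor C X Y"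
  shows "Plus C f (Zero C X Y) = f"
proof -
  interpret G: comm_group "hom_group C X Y"
    using assms(1) Mor_Obj hom_comm_group by blast
  show ?thesis using G.r_one assms by (simp add: hom_group_def)
qed

lemma Plus_Neg:
  assumes "f \<in> Mor C X Y"
  shows "Neg C f \<in> Mor C X Y" "Plus C f (Neg C f) = Zero C X Y"
proof -
  interpret G: comm_group "hom_group C X Y"
    using assms(1) Mor_Obj hom_comm_group by blast
  have "Neg C f = inv\<^bsub>hom_group C X Y\<^esub> f"
    using assms by (simp add: Neg_def Mor_def)
  then show "Neg C f \<in> Mor C X Y" "Plus C f (Neg C f) = Zero C X Y"
    using G.inv_closed G.r_inv assms by (simp_all add: hom_group_def)
qed

lemma Plus_idem:
  assumes f: "f \<in> Mor C X Y" and "Plus C f f = f"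
  shows "f = Zero C X Y"
proof -
  have "Plus C (Plus C f f) (Neg C f) = f"
    using Plus_assoc[OF f f] Plus_Neg[OF f] Plus_Zero[OF f] by simp
  then show ?thesis
    using assms Plus_Neg[OF f] by simp
qed

lemma Comp_Zero:
  assumes "X \<in> Obj C" "g \<in> Mor C Y Z"
  shows "g \<cdot> Zero C X Y = Zero C X Z"
proof -
  have z: "Zero C X Y \<in> Mor C X Y" using Zero_Mor assms Mor_Obj by blast
  show ?thesis
    using Plus_idem[OF Comp_Mor[OF z assms(2)]] Comp_Plus[OF z z assms(2)] Plus_Zero[OF z] by simp
qed

lemma Zero_Comp:
  assumes "Z \<in> Obj C" "f \<in> Mor C X Y"
  shows "Zero C Y Z \<cdot> f = Zero C X Z"
proof -
  have z: "Zero C Y Z \<in> Mor C Y Z" using Zero_Mor assms Mor_Obj by blast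
  show ?thesis
    using Plus_idem[OF Comp_Mor[OF assms(2) z]] Plus_Comp[OF assms(2) z z] Plus_Zero[OF z] by simp
qed

lemma zero_object_iff: "zero_object C Z \<longleftrightarrow> Z \<in> Obj C \<and> Ident C Z = Zero C Z Z"
proof
  assume "zero_object C Z"
  then show "Z \<in> Obj C \<and> Ident C Z = Zero C Z Z"
    using Ident_Mor Zero_Mor unfolding zero_object_def by blast
next
  assume Z: "Z \<in> Obj C \<and> Ident C Z = Zero C Z Z"
  have "f = Zero C Z X" if "f \<in> Mor C Z X" for f X
    using Comp_Ident[OF that] Comp_Zero[OF _ that] Z by simp
  moreover have "f = Zero C X Z" if "f \<in> Mor C X Z" for f X
    using Ident_Comp[OF that] Zero_Comp[OF _ that] Z by simp
  ultimately show "zero_object C Z"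
    unfolding zero_object_def using Z Zero_Mor by blast
qed

lemma through_zero_object:
  assumes "zero_object C Z" "f \<in> Mor C X Z" "g \<in> Mor C Z Y"
  shows "g \<cdot> f = Zero C X Y"
proof -
  have "f = Zero C X Z"
    using assms Mor_Obj[OF assms(2)] Zero_Mor unfolding zero_object_def by blast
  then show ?thesis
    using Comp_Zero assms(3) Mor_Obj[OF assms(2)] by simp
qed

text \<open>The inverse is the truncated geometric series \<open>1 - e\<close>.\<close>

lemma unipotent_invertible:
  assumes e: "e \<in> Mor C X X" and sq: "e \<cdot> e = Zero C X X"
  shows "\<exists>u \<in> Mor C X X. u \<cdot> Plus C (Ident C X) e = Ident C X \<and>
    Plus C (Ident C X) e \<cdot> u = Ident C X"
proof -
  let ?m = "Neg C e" and ?I = "Ident C X" and ?N = "Zero C X X"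
  have O: "X \<in> Obj C" using e Mor_Obj by blast
  note m = Plus_Neg[OF e] and i = Ident_Mor[OF O] and z = Zero_Mor[OF O O]
  have "Plus C (e \<cdot> e) (e \<cdot> ?m) = ?N"
    using Comp_Plus[OF e m(1) e] m(2) Comp_Zero[OF O e] by simp
  then have em: "e \<cdot> ?m = ?N"
    using sq Plus_comm[OF z] Plus_Zero Comp_Mor[OF m(1) e] by simp
  have "Plus C (e \<cdot> e) (?m \<cdot> e) = ?N"
    using Plus_Comp[OF e e m(1)] m(2) Zero_Comp[OF O e] by simp
  then have me: "?m \<cdot> e = ?N"
    using sq Plus_comm[OF z] Plus_Zero Comp_Mor[OF e m(1)] by simp
  have p: "Plus C ?I e \<in> Mor C X X" "Plus C ?I ?m \<in> Mor C X X"
    using Plus_Mor i e m(1) by blast+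
  have "Plus C ?I ?m \<cdot> Plus C ?I e = Plus C (Plus C ?I e) (?m \<cdot> Plus C ?I e)"
    using Plus_Comp[OF p(1) i m(1)] Ident_Comp[OF p(1)] by simp
  also have "\<dots> = Plus C (Plus C ?I e) ?m"
    using Comp_Plus[OF i e m(1)] Comp_Ident[OF m(1)] me Plus_Zero[OF m(1)] by simp
  also have "\<dots> = ?I"
    using Plus_assoc[OF i e m(1)] m(2) Plus_Zero[OF i] by simp
  finally have 1: "Plus C ?I ?m \<cdot> Plus C ?I e = ?I" .
  have "Plus C ?I e \<cdot> Plus C ?I ?m = Plus C (Plus C ?I e) (Plus C ?I e \<cdot> ?m)"
    using Comp_Plus[OF i m(1) p(1)] Comp_Ident[OF p(1)] by simp
  also have "\<dots> = Plus C (Plus C ?I e) ?m"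
    using Plus_Comp[OF m(1) i e] Ident_Comp[OF m(1)] em Plus_Zero[OF m(1)] by simp
  also have "\<dots> = ?I"
    using Plus_assoc[OF i e m(1)] m(2) Plus_Zero[OF i] by simp
  finally show ?thesis using 1 p(2) by blast
qed

end

lemma (in additive_functor) on_Zero:
  assumes A: "additive_category A" and B: "additive_category B" and O: "X \<in> Obj A" "Y \<in> Obj A"
  shows "on_Arr F (Zero A X Y) = Zero B (on_Obj F X) (on_Obj F Y)"
proof -
  note z = additive_category.Zero_Mor[OF A O]
  show ?thesis
    using additive_category.Plus_idem[OF B on_Arr[OF z]] on_Plus[OF z z]
      additive_category.Plus_Zero[OF A z] by simp
qed

lemma (in additive_functor) zero_object_on_Obj:
  assumes "additive_category A" "additive_category B" "zero_object A Z"
  shows "zero_object B (on_Obj F Z)"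
  using assms on_Zero[OF assms(1,2)] on_Ident on_Obj additive_category.zero_object_iff by metis

lemma (in additive_functor) nilpotent_on_Arr:
  assumes "additive_category A" "additive_category B" "nilpotent_endo A X f"
  shows "nilpotent_endo B (on_Obj F X) (on_Arr F f)"
  using assms on_Zero[OF assms(1,2)] on_Pow_arr on_Arr A.Mor_Obj unfolding nilpotent_endo_def
  by metis


section \<open>Distinguished triangles\<close>

context triangulated_category
begin

lemma DistE:
  assumes "(f, g, h) \<in> Dist C"
  obtains X Y Z where "f \<in> Mor C X Y" "g \<in> Mor C Y Z" "h \<in> Mor C Z (ShO C X)"
  using assms Dist_triangles unfolding triangles_def Mor_def by fastforce

lemma Dist_fromE:
  assumes D: "(f, g, h) \<in> Dist C" and f: "f \<in> Mor C X Y"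
  obtains Z where "g \<in> Mor C Y Z" "h \<in> Mor C Z (ShO C X)"
proof -
  obtain X' Y' Z where m: "f \<in> Mor C X' Y'" "g \<in> Mor C Y' Z" "h \<in> Mor C Z (ShO C X')"
    using D by (rule DistE)
  have "X' = X" "Y' = Y" using m(1) f by (simp_all add: Mor_def)
  then show ?thesis using that m(2,3) by simp
qed

lemma shift_Mor: "f \<in> Mor C X Y \<Longrightarrow> ShA C f \<in> Mor C (ShO C X) (ShO C Y)"
  using shift.on_Arr[of f X Y] by (simp add: shift_def)

lemma shift_Obj: "X \<in> Obj C \<Longrightarrow> ShO C X \<in> Obj C"
  using shift.on_Obj[of X] by (simp add: shift_def)

lemma shift_Ident: "X \<in> Obj C \<Longrightarrow> ShA C (Ident C X) = Ident C (ShO C X)"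
  using shift.on_Ident[of X] by (simp add: shift_def)

lemma rotate: "(f, g, h) \<in> Dist C \<Longrightarrow> (g, h, Neg C (ShA C f)) \<in> Dist C"
  using TR2 Dist_triangles by blast

text \<open>This is the axiomatic triangle on the identity of \<open>W\<close>, rotated backwards. Its third vertex
  is the shift of \<open>Z\<close>, which is again a zero object, so that the sign introduced by the rotation
  disappears.\<close>

lemma zero_start_Dist:
  assumes W: "W \<in> Obj C" and Z: "zero_object C Z"
  shows "(Zero C Z W, Ident C W, Zero C W (ShO C Z)) \<in> Dist C"
proof -
  have O: "Z \<in> Obj C" using Z by (simp add: zero_object_def)
  have sZ: "zero_object C (ShO C Z)"
    using shift.zero_object_on_Obj[OF additive_category_axioms additive_category_axioms Z]
    by (simp add: shift_def)
  note m = Zero_Mor[OF O W] Ident_Mor[OF W] Zero_Mor[OF W shift_Obj[OF O]]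
  have "Neg C (ShA C (Zero C Z W)) = Zero C (ShO C Z) (ShO C W)"
    using sZ Plus_Neg(1)[OF shift_Mor[OF m(1)]] Zero_Mor shift_Obj O W
    unfolding zero_object_def by blast
  then have "(Ident C W, Zero C W (ShO C Z), Neg C (ShA C (Zero C Z W))) \<in> Dist C"
    using TR1_ident[OF W sZ] by simp
  moreover have "(Zero C Z W, Ident C W, Zero C W (ShO C Z)) \<in> triangles C"
    using m by (auto simp: triangles_def Mor_def)
  ultimately show ?thesis using TR2 by blast
qed

text \<open>The pair consisting of a zero arrow and \<open>b\<close> extends to a morphism of triangles into
  \<open>Z0 \<rightarrow> W \<rightarrow> W\<close>; its third component is the required factorisation.\<close>

lemma weak_cokernel:
  assumes D: "(f, g, h) \<in> Dist C" and f: "f \<in> Mor C X Y" and g: "g \<in> Mor C Y Z"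
    and b: "b \<in> Mor C Y W" "b \<cdot> f = Zero C X W"
  obtains c where "c \<in> Mor C Z W" "c \<cdot> g = b"
proof -
  obtain Z0 where Z0: "zero_object C Z0" using has_zero_object by blast
  have O: "X \<in> Obj C" "Z0 \<in> Obj C" "W \<in> Obj C"
    using f b Z0 Mor_Obj by (auto simp: zero_object_def)
  note D' = zero_start_Dist[OF O(3) Z0]
  have h: "Dom C h = Z" using DistE[OF D] g by (auto simp: Mor_def)
  note m = Zero_Mor[OF O(2,3)] Ident_Mor[OF O(3)] Zero_Mor[OF O(3) shift_Obj[OF O(2)]]
    Zero_Mor[OF O(1,2)]
  have "b \<cdot> f = Zero C Z0 W \<cdot> Zero C X Z0"
    using b(2) through_zero_object[OF Z0 m(4,1)] by simp
  then obtain c where "c \<in> Mor C Z W" "c \<cdot> g = Ident C W \<cdot> b"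
    using TR3[OF D D', of "Zero C X Z0" b] m f g b(1) h by (auto simp: Mor_def)
  then show ?thesis using that Ident_Comp[OF b(1)] by simp
qed

text \<open>The difference \<open>e = x - 1\<close> is killed by \<open>g\<close> on one side and by \<open>h\<close> on the other. The first
  makes \<open>e\<close> factor through \<open>h\<close>, and the second then gives \<open>e \<cdot> e = 0\<close>. This replaces the five
  lemma for long exact sequences in the proof that cones are unique.\<close>

lemma cone_endo_invertible:
  assumes D: "(f, g, h) \<in> Dist C" and g: "g \<in> Mor C Y Z" and h: "h \<in> Mor C Z W"
    and x: "x \<in> Mor C Z Z" "x \<cdot> g = g" "h \<cdot> x = h"
  shows "\<exists>u \<in> Mor C Z Z. u \<cdot> x = Ident C Z \<and> x \<cdot> u = Ident C Z"
proof -
  have O: "Y \<in> Obj C" "Z \<in> Obj C" "W \<in> Obj C" using g h Mor_Obj by auto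
  let ?m = "Neg C (Ident C Z)"
  let ?e = "Plus C x ?m"
  note i = Ident_Mor[OF O(2)]
  note m = Plus_Neg[OF i]
  have e: "?e \<in> Mor C Z Z" using Plus_Mor x(1) m(1) .
  have "?e \<cdot> g = Plus C (Ident C Z) ?m \<cdot> g"
    using Plus_Comp[OF g x(1) m(1)] Plus_Comp[OF g i m(1)] x(2) Ident_Comp[OF g] by simp
  then have eg: "?e \<cdot> g = Zero C Y Z" using m(2) Zero_Comp[OF O(2) g] by simp
  have "h \<cdot> ?e = h \<cdot> Plus C (Ident C Z) ?m"
    using Comp_Plus[OF x(1) m(1) h] Comp_Plus[OF i m(1) h] x(3) Comp_Ident[OF h] by simp
  then have he: "h \<cdot> ?e = Zero C Z W" using m(2) Comp_Zero[OF O(2) h] by simp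
  obtain c where c: "c \<in> Mor C W Z" "c \<cdot> h = ?e"
    using weak_cokernel[OF rotate[OF D] g h e eg] .
  have "?e \<cdot> ?e = c \<cdot> (h \<cdot> ?e)"
    using Comp_assoc[OF e h c(1)] c(2) by simp
  then have "?e \<cdot> ?e = Zero C Z Z"
    using he Comp_Zero[OF O(2) c(1)] by simp
  moreover have "Plus C (Ident C Z) ?e = x"
    using Plus_comm[OF i e] Plus_assoc[OF x(1) m(1) i] Plus_comm[OF i m(1)] m(2) Plus_Zero[OF x(1)]
    by simp
  ultimately show ?thesis using unipotent_invertible[OF e] by simp
qed

text \<open>The comparison maps in the two directions are not mutually inverse in general, but both of
  their composites are invertible by the previous lemma.\<close>

lemma cone_unique:
  assumes D: "(f, g, h) \<in> Dist C" and D': "(f, g', h') \<in> Dist C"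
  shows "isomorphic C (Cod C g) (Cod C g')"
proof -
  obtain X Y Z where m: "f \<in> Mor C X Y" "g \<in> Mor C Y Z" "h \<in> Mor C Z (ShO C X)"
    using D by (rule DistE)
  obtain Z' where m': "g' \<in> Mor C Y Z'" "h' \<in> Mor C Z' (ShO C X)"
    using Dist_fromE[OF D' m(1)] .
  have O: "X \<in> Obj C" "Y \<in> Obj C" using m(1) Mor_Obj by auto
  have *: "\<exists>c \<in> Mor C Z1 Z2. c \<cdot> g1 = g2 \<and> h2 \<cdot> c = h1"
    if "(f, g1, h1) \<in> Dist C" "(f, g2, h2) \<in> Dist C"
      "g1 \<in> Mor C Y Z1" "h1 \<in> Mor C Z1 (ShO C X)" "g2 \<in> Mor C Y Z2" "h2 \<in> Mor C Z2 (ShO C X)"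
    for g1 g2 h1 h2 Z1 Z2
  proof -
    have d: "Dom C f = X" "Dom C g1 = Y" "Dom C h1 = Z1" "Dom C g2 = Y" "Dom C h2 = Z2"
      using m(1) that(3-) by (auto simp: Mor_def)
    show ?thesis
      using TR3[OF that(1,2), of "Ident C X" "Ident C Y"] Ident_Mor[OF O(1)] Ident_Mor[OF O(2)]
        Ident_Comp[OF m(1)] Comp_Ident[OF m(1)] Comp_Ident[OF that(5)] Ident_Comp[OF that(4)]
        shift_Ident[OF O(1)]
      unfolding d by auto
  qed
  obtain c where c: "c \<in> Mor C Z Z'" "c \<cdot> g = g'" "h' \<cdot> c = h"
    using *[OF D D' m(2,3) m'] by blast
  obtain d where d: "d \<in> Mor C Z' Z" "d \<cdot> g' = g" "h \<cdot> d = h'"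
    using *[OF D' D m' m(2,3)] by blast
  have "\<exists>u \<in> Mor C Z Z. u \<cdot> (d \<cdot> c) = Ident C Z \<and> (d \<cdot> c) \<cdot> u = Ident C Z"
    using cone_endo_invertible[OF D m(2,3) Comp_Mor[OF c(1) d(1)]]
      Comp_assoc[OF m(2) c(1) d(1)] Comp_assoc[OF c(1) d(1) m(3)] c d by simp
  then obtain u where u: "u \<in> Mor C Z Z" "u \<cdot> (d \<cdot> c) = Ident C Z" by blast
  have "\<exists>v \<in> Mor C Z' Z'. v \<cdot> (c \<cdot> d) = Ident C Z' \<and> (c \<cdot> d) \<cdot> v = Ident C Z'"
    using cone_endo_invertible[OF D' m' Comp_Mor[OF d(1) c(1)]]
      Comp_assoc[OF m'(1) d(1) c(1)] Comp_assoc[OF d(1) c(1) m'(2)] c d by simp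
  then obtain v where v: "v \<in> Mor C Z' Z'" "(c \<cdot> d) \<cdot> v = Ident C Z'" by blast
  have "isomorphic C Z Z'"
    by (rule isomorphicI_left_right[OF c(1) Comp_Mor[OF d(1) u(1)] Comp_Mor[OF v(1) d(1)]])
      (use Comp_assoc[OF c(1) d(1) u(1)] Comp_assoc[OF v(1) d(1) c(1)] u v in simp_all)
  then show ?thesis using m(2) m'(1) by (simp add: Mor_def)
qed

text \<open>Transporting the first triangle along \<open>a\<close> and \<open>b\<close> gives a triangle on \<open>f'\<close> with the same
  third vertex.\<close>

lemma cone_unique_iso:
  assumes D: "(f, g, h) \<in> Dist C" and D': "(f', g', h') \<in> Dist C"
    and f: "f \<in> Mor C X Y" and f': "f' \<in> Mor C X' Y'"
    and a: "a \<in> Mor C X X'" "iso_arrow C a" and b: "b \<in> Mor C Y Y'" "iso_arrow C b"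
    and sq: "b \<cdot> f = f' \<cdot> a"
  shows "isomorphic C (Cod C g) (Cod C g')"
proof -
  obtain Z where m: "g \<in> Mor C Y Z" "h \<in> Mor C Z (ShO C X)"
    using Dist_fromE[OF D f] .
  note b' = inv_arrow[OF b(2,1)]
  let ?g = "g \<cdot> inv_arrow C b" and ?h = "ShA C a \<cdot> h"
  have g: "?g \<in> Mor C Y' Z" using Comp_Mor[OF b'(1) m(1)] .
  have h: "?h \<in> Mor C Z (ShO C X')" using Comp_Mor[OF m(2) shift_Mor[OF a(1)]] .
  have O: "Z \<in> Obj C" using m Mor_Obj by auto
  note i = Ident_Mor[OF O]
  have "?g \<cdot> b = g" using Comp_assoc[OF b(1) b'(1) m(1)] b'(2) Comp_Ident[OF m(1)] by simp
  then have "Ident C Z \<cdot> g = ?g \<cdot> b" using Ident_Comp[OF m(1)] by simp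
  moreover have "?h = ?h \<cdot> Ident C Z" using Comp_Ident[OF h] by simp
  moreover have "iso_arrow C (Ident C Z)" using iso_arrowI[OF i i] Comp_Ident[OF i] by simp
  moreover have "(f', ?g, ?h) \<in> triangles C"
    using f' g h by (auto simp: triangles_def Mor_def)
  ultimately have "(f', ?g, ?h) \<in> Dist C"
    using TR1_iso[OF D, of f' ?g ?h a b "Ident C Z"] a b i f f' g h m sq by (auto simp: Mor_def)
  then show ?thesis using cone_unique[OF _ D'] g m(1) by (fastforce simp: Mor_def)
qed

lemma cone_Dist:
  assumes "f \<in> Arr C"
  obtains g h where "(f, g, h) \<in> Dist C" "Cod C g = cone C f"
  using someI_ex[of "\<lambda>Z. \<exists>g h. (f, g, h) \<in> Dist C \<and> Cod C g = Z"] TR1_cone[OF assms]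
  unfolding cone_def by blast

end

lemma (in triangulated_functor) cone_on_Arr:
  assumes "f \<in> Arr A"
  shows "isomorphic B (cone B (on_Arr F f)) (on_Obj F (cone A f))"
proof -
  obtain g h where D: "(f, g, h) \<in> Dist A" "Cod A g = cone A f"
    using A.cone_Dist[OF assms] .
  have "on_Arr F f \<in> Arr B"
    using on_Arr[of f "Dom A f" "Cod A f"] assms by (auto simp: Mor_def)
  then obtain g' h' where D': "(on_Arr F f, g', h') \<in> Dist B" "Cod B g' = cone B (on_Arr F f)"
    using B.cone_Dist by blast
  obtain Y Z where "g \<in> Mor A Y Z" using A.DistE[OF D(1)] .
  then have "Cod B (on_Arr F g) = on_Obj F (cone A f)"
    using on_Arr[of g Y Z] D(2) by (auto simp: Mor_def)
  then show ?thesis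
    using B.cone_unique[OF D'(1) on_Dist[OF D(1)]] D'(2) by simp
qed


section \<open>The essential image of a triangulated embedding\<close>

locale triangulated_embedding = triangulated_functor A B F
  for A :: "('o, 'm, 'x) tricat_scheme" (structure)
    and B :: "('p, 'n, 'y) tricat_scheme" (structure)
    and F :: "('o, 'm, 'p, 'n, 'z) trifunct_scheme" +
  assumes fully_faithful: "fully_faithful A B F"
begin

definition ess_image where
  "ess_image = {Y. \<exists>X \<in> Obj A. isomorphic B (on_Obj F X) Y}"

lemma ess_image_iso: "\<lbrakk>Y \<in> ess_image; isomorphic B Y Y'\<rbrakk> \<Longrightarrow> Y' \<in> ess_image"
  using B.isomorphic_trans unfolding ess_image_def by blast

lemma ess_image_on_Obj: "X \<in> Obj A \<Longrightarrow> on_Obj F X \<in> ess_image"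
  using B.isomorphic_refl on_Obj unfolding ess_image_def by blast

lemma on_Obj_shift:
  assumes "X \<in> Obj A"
  shows "isomorphic B (on_Obj F (ShO A X)) (ShO B (on_Obj F X))"
  using on_Shift_Mor[OF assms] on_Shift_iso[OF assms] B.Mor_Obj unfolding isomorphic_def by blast

text \<open>The shift is essentially surjective on \<open>A\<close> and reflects isomorphisms on \<open>B\<close>, so an object of
  \<open>A\<close> that represents the shift of \<open>Y\<close> can be shifted back.\<close>

lemma ess_image_unshift:
  assumes Y: "Y \<in> Obj B" and "ShO B Y \<in> ess_image"
  shows "Y \<in> ess_image"
proof -
  obtain X where X: "X \<in> Obj A" "isomorphic B (on_Obj F X) (ShO B Y)"
    using assms(2) unfolding ess_image_def by blast
  obtain X' where X': "X' \<in> Obj A" "isomorphic A (ShO A X') X"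
    using A.shift_essentially_surjective X(1) unfolding essentially_surjective_def
    by (auto simp: shift_def)
  have "isomorphic B (ShO B (on_Obj F X')) (ShO B Y)"
    using on_Obj_shift[OF X'(1)] isomorphic_on_Obj[OF X'(2)] X(2)
    by (meson B.isomorphic_sym B.isomorphic_trans)
  then have "isomorphic B (on_Obj F X') Y"
    using B.shift.fully_faithful_reflects_isomorphic[OF B.shift_fully_faithful on_Obj[OF X'(1)] Y]
    by (simp add: shift_def)
  then show ?thesis using X'(1) unfolding ess_image_def by blast
qed

text \<open>Fullness lifts \<open>w\<close> to \<open>A\<close>; the image of a cone of the lift is a cone of \<open>w\<close>.\<close>

lemma ess_image_cone:
  assumes D: "(w, g, h) \<in> Dist B" and w: "w \<in> Mor B Y Y'" and "Y \<in> ess_image" "Y' \<in> ess_image"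
  shows "Cod B g \<in> ess_image"
proof -
  obtain X X' where X: "X \<in> Obj A" "isomorphic B (on_Obj F X) Y"
      "X' \<in> Obj A" "isomorphic B (on_Obj F X') Y'"
    using assms(3,4) unfolding ess_image_def by blast
  obtain a where a: "a \<in> Mor B (on_Obj F X) Y" "iso_arrow B a"
    using X(2) by (rule B.isomorphicE)
  obtain b b' where b: "b \<in> Mor B (on_Obj F X') Y'" "b' \<in> Mor B Y' (on_Obj F X')"
      "b \<cdot>\<^bsub>B\<^esub> b' = Ident B Y'" "iso_arrow B b"
    using X(4) by (rule B.isomorphicE)
  have wa: "w \<cdot>\<^bsub>B\<^esub> a \<in> Mor B (on_Obj F X) Y'" using B.Comp_Mor a(1) w .
  obtain v where v: "v \<in> Mor A X X'" "on_Arr F v = b' \<cdot>\<^bsub>B\<^esub> (w \<cdot>\<^bsub>B\<^esub> a)"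
    using fully_faithful_full[OF fully_faithful X(1,3) B.Comp_Mor[OF wa b(2)]] .
  have sq: "b \<cdot>\<^bsub>B\<^esub> on_Arr F v = w \<cdot>\<^bsub>B\<^esub> a"
    using v(2) B.Comp_assoc[OF wa b(2,1)] b(3) B.Ident_Comp[OF wa] by simp
  have "v \<in> Arr A" using v by (simp add: Mor_def)
  then obtain p q where D': "(v, p, q) \<in> Dist A" using A.TR1_cone by blast
  obtain P Q where p: "p \<in> Mor A P Q" using A.DistE[OF D'] .
  have "isomorphic B (Cod B (on_Arr F p)) (Cod B g)"
    using B.cone_unique_iso[OF on_Dist[OF D'] D on_Arr[OF v(1)] w a(1,2) b(1,4) sq] .
  moreover have "Cod B (on_Arr F p) = on_Obj F Q" "Q \<in> Obj A"
    using on_Arr[OF p] A.Mor_Obj[OF p] by (auto simp: Mor_def)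
  ultimately show ?thesis unfolding ess_image_def by auto
qed

text \<open>The retraction defines an idempotent on an object of \<open>A\<close>, which splits there through an
  object whose image is \<open>W\<close>.\<close>

lemma ess_image_retract:
  assumes split: "split_idempotents A" and Y: "Y \<in> ess_image"
    and s: "s \<in> Mor B W Y" and r: "r \<in> Mor B Y W" and rs: "r \<cdot>\<^bsub>B\<^esub> s = Ident B W"
  shows "W \<in> ess_image"
proof -
  obtain X where X: "X \<in> Obj A" "isomorphic B (on_Obj F X) Y"
    using Y unfolding ess_image_def by blast
  obtain a b where a: "a \<in> Mor B (on_Obj F X) Y" "b \<in> Mor B Y (on_Obj F X)"
      "b \<cdot>\<^bsub>B\<^esub> a = Ident B (on_Obj F X)" "a \<cdot>\<^bsub>B\<^esub> b = Ident B Y"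
    using X(2) by (rule B.isomorphicE)
  let ?s = "b \<cdot>\<^bsub>B\<^esub> s" and ?r = "r \<cdot>\<^bsub>B\<^esub> a"
  have m: "?s \<in> Mor B W (on_Obj F X)" "?r \<in> Mor B (on_Obj F X) W"
    using B.Comp_Mor s r a by blast+
  have rs': "?r \<cdot>\<^bsub>B\<^esub> ?s = Ident B W"
    using B.comp_cancel_middle[OF s a(2,1) r a(4)] rs by simp
  obtain e where e: "e \<in> Mor A X X" "on_Arr F e = ?s \<cdot>\<^bsub>B\<^esub> ?r"
    using fully_faithful_full[OF fully_faithful X(1) X(1) B.Comp_Mor[OF m(2,1)]] .
  have "on_Arr F (e \<cdot> e) = on_Arr F e"
    using on_Comp[OF e(1,1)] e(2) B.comp_cancel_middle[OF m(2,1,2,1) rs'] by simp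
  then have "e \<cdot> e = e"
    using fully_faithful_faithful[OF fully_faithful A.Comp_Mor[OF e(1,1)] e(1)] by simp
  then obtain V p i where V: "V \<in> Obj A" "p \<in> Mor A X V" "i \<in> Mor A V X"
      "i \<cdot> p = e" "p \<cdot> i = Ident A V"
    using split X(1) e(1) unfolding split_idempotents_def by blast
  note F = on_Arr[OF V(2)] on_Arr[OF V(3)]
  have pi: "on_Arr F p \<cdot>\<^bsub>B\<^esub> on_Arr F i = Ident B (on_Obj F V)"
    "on_Arr F i \<cdot>\<^bsub>B\<^esub> on_Arr F p = ?s \<cdot>\<^bsub>B\<^esub> ?r"
    using on_Comp[OF V(2,3)] on_Comp[OF V(3,2)] V on_Ident e by simp_all
  let ?u = "?r \<cdot>\<^bsub>B\<^esub> on_Arr F i" and ?v = "on_Arr F p \<cdot>\<^bsub>B\<^esub> ?s"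
  note uv = B.Comp_Mor[OF F(2) m(2)] B.Comp_Mor[OF m(1) F(1)]
  have "?v \<cdot>\<^bsub>B\<^esub> ?u = on_Arr F p \<cdot>\<^bsub>B\<^esub> ((?s \<cdot>\<^bsub>B\<^esub> ?r) \<cdot>\<^bsub>B\<^esub> on_Arr F i)"
    using B.Comp_assoc[OF uv(1) m(1) F(1)] B.Comp_assoc[OF F(2) m(2,1)] by simp
  also have "\<dots> = on_Arr F p \<cdot>\<^bsub>B\<^esub> (on_Arr F i \<cdot>\<^bsub>B\<^esub> (on_Arr F p \<cdot>\<^bsub>B\<^esub> on_Arr F i))"
    using B.Comp_assoc[OF F(2,1,2)] pi(2) by simp
  also have "\<dots> = Ident B (on_Obj F V)"
    using pi(1) B.Comp_Ident[OF F(2)] by simp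
  finally have vu: "?v \<cdot>\<^bsub>B\<^esub> ?u = Ident B (on_Obj F V)" .
  have "?u \<cdot>\<^bsub>B\<^esub> ?v = ?r \<cdot>\<^bsub>B\<^esub> ((on_Arr F i \<cdot>\<^bsub>B\<^esub> on_Arr F p) \<cdot>\<^bsub>B\<^esub> ?s)"
    using B.Comp_assoc[OF uv(2) F(2) m(2)] B.Comp_assoc[OF m(1) F] by simp
  also have "\<dots> = (?r \<cdot>\<^bsub>B\<^esub> ?s) \<cdot>\<^bsub>B\<^esub> (?r \<cdot>\<^bsub>B\<^esub> ?s)"
    using B.Comp_assoc[OF m m(1)] B.Comp_assoc[OF B.Comp_Mor[OF m] m] pi(2) by simp
  also have "\<dots> = Ident B W"
    using rs' B.Ident_Comp[OF B.Ident_Mor] B.Mor_Obj[OF s] by simp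
  finally have "isomorphic B (on_Obj F V) W"
    using B.isomorphicI[OF uv vu] by simp
  then show ?thesis using V(1) unfolding ess_image_def by blast
qed

text \<open>The octahedron on \<open>f \<cdot> f ^ n\<close>, rotated twice, exhibits the shift of the cone of \<open>f ^ (n + 1)\<close>
  as a cone of an arrow from the cone of \<open>f\<close> to the shift of the cone of \<open>f ^ n\<close>. Stating the
  claim for the shifted cones makes the induction hypothesis apply to exactly this arrow.\<close>

lemma ess_image_cone_Pow:
  assumes f: "f \<in> Mor B W W" and D: "(f, g, h) \<in> Dist B" and "Cod B g \<in> ess_image"
    and "(Pow_arr B W f n, g', h') \<in> Dist B"
  shows "ShO B (Cod B g') \<in> ess_image"
  using assms(4)
proof (induction n arbitrary: g' h')
  case 0
  obtain Z where Z: "zero_object A Z" using A.has_zero_object by blast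
  have ZB: "zero_object B (on_Obj F (ShO A Z))" "zero_object B (on_Obj F Z)"
    using zero_object_on_Obj[OF A.additive_category_axioms B.additive_category_axioms]
      A.shift.zero_object_on_Obj[OF A.additive_category_axioms A.additive_category_axioms Z] Z
    by (auto simp: shift_def)
  have W: "W \<in> Obj B" using f B.Mor_Obj by blast
  have "isomorphic B (on_Obj F Z) (Cod B g')"
    using B.cone_unique[OF B.TR1_ident[OF W ZB(2)], of g' h'] 0
      B.Zero_Mor[OF W] ZB(2) by (simp add: Mor_def zero_object_def)
  then have "isomorphic B (ShO B (on_Obj F Z)) (ShO B (Cod B g'))"
    using B.shift.isomorphic_on_Obj by (fastforce simp: shift_def)
  then show ?case
    using on_Obj_shift Z B.isomorphic_trans A.shift_Obj unfolding ess_image_def zero_object_def by blast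
next
  case (Suc n)
  let ?p = "Pow_arr B W f n"
  have p: "?p \<in> Mor B W W" using B.Pow_arr_Mor[OF f] .
  obtain p1 p2 where P: "(?p, p1, p2) \<in> Dist B"
    using B.TR1_cone[of ?p] p by (auto simp: Mor_def)
  have D': "(f \<cdot>\<^bsub>B\<^esub> ?p, g', h') \<in> Dist B" using Suc.prems by simp
  obtain u v where uv: "u \<in> Mor B (Cod B p1) (Cod B g')" "v \<in> Mor B (Cod B g') (Cod B g)"
      "(u, v, ShA B p1 \<cdot>\<^bsub>B\<^esub> h) \<in> Dist B"
    using B.TR4[OF p f P D D'] by blast
  let ?w = "ShA B p1 \<cdot>\<^bsub>B\<^esub> h"
  have w: "?w \<in> Mor B (Cod B g) (ShO B (Cod B p1))"
  proof -
    obtain V where V: "v \<in> Mor B (Cod B g') V" "?w \<in> Mor B V (ShO B (Cod B p1))"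
      using B.Dist_fromE[OF uv(3,1)] .
    have "V = Cod B g" using V(1) uv(2) by (simp add: Mor_def)
    then show ?thesis using V(2) by simp
  qed
  have "Cod B (Neg B (ShA B u)) \<in> ess_image"
    using ess_image_cone[OF B.rotate[OF B.rotate[OF uv(3)]] w assms(3) Suc.IH[OF P]] .
  moreover have "Cod B (Neg B (ShA B u)) = ShO B (Cod B g')"
    using B.Plus_Neg(1)[OF B.shift_Mor[OF uv(1)]] by (simp add: Mor_def)
  ultimately show ?case by simp
qed

text \<open>When \<open>f ^ n = 0\<close>, the identity of \<open>W\<close> composed with \<open>f ^ n\<close> vanishes, so it factors through
  the arrow from \<open>W\<close> to the cone of \<open>f ^ n\<close>; thus \<open>W\<close> is a retract of that cone.\<close>

lemma ess_image_nilpotent: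
  assumes "split_idempotents A" and nil: "nilpotent_endo B W f" and "cone B f \<in> ess_image"
  shows "W \<in> ess_image"
proof -
  obtain n where f: "f \<in> Mor B W W" and n: "Pow_arr B W f n = Zero B W W"
    using nil unfolding nilpotent_endo_def by blast
  have W: "W \<in> Obj B" using f B.Mor_Obj by blast
  obtain g h where D: "(f, g, h) \<in> Dist B" "Cod B g = cone B f"
    using B.cone_Dist f by (auto simp: Mor_def)
  note z = B.Zero_Mor[OF W W]
  obtain g' h' where D': "(Zero B W W, g', h') \<in> Dist B"
    using B.TR1_cone[of "Zero B W W"] z by (auto simp: Mor_def)
  obtain Z where g': "g' \<in> Mor B W Z"
    using B.Dist_fromE[OF D' z] .
  have TZ: "ShO B Z \<in> ess_image"
    using ess_image_cone_Pow[OF f D(1), of n g' h'] D(2) assms(3) n D' g' by (simp add: Mor_def)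
  obtain r where r: "r \<in> Mor B Z W" "r \<cdot>\<^bsub>B\<^esub> g' = Ident B W"
    using B.weak_cokernel[OF D' z g' B.Ident_Mor[OF W] B.Ident_Comp[OF z]] .
  have "ShA B r \<cdot>\<^bsub>B\<^esub> ShA B g' = Ident B (ShO B W)"
    using B.shift.on_Comp[OF g' r(1)] r(2) B.shift_Ident[OF W] by (simp add: shift_def)
  then have "ShO B W \<in> ess_image"
    using ess_image_retract[OF assms(1) TZ B.shift_Mor[OF g'] B.shift_Mor[OF r(1)]] by simp
  then show ?thesis using ess_image_unshift W by blast
qed

end


section \<open>Inverting a central endomorphism\<close>

text \<open>Formal inverses are read as identities, which is possible because the inverted arrows are
  endomorphisms. In the case of interest a zigzag represents its numerator divided by a power
  of \<open>t\<close>; the exponent, the number of formal inverses, is not recorded.\<close>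

fun numerator :: "('o, 'm, 'x) cat_scheme \<Rightarrow> 'o \<Rightarrow> 'm step list \<Rightarrow> 'm" where
  "numerator C X [] = Ident C X"
| "numerator C X (Fwd f # as) = numerator C (Cod C f) as \<cdot>\<^bsub>C\<^esub> f"
| "numerator C X (Bwd s # as) = numerator C (Dom C s) as"

locale central_endo = category C
  for C :: "('o, 'm, 'x) cat_scheme" (structure) +
  fixes t :: "'o \<Rightarrow> 'm"
  assumes t_Mor: "X \<in> Obj C \<Longrightarrow> t X \<in> Mor C X X"
    and t_natural: "f \<in> Mor C X Y \<Longrightarrow> t Y \<cdot> f = f \<cdot> t X"
begin

abbreviation inverted :: "'m set" where
  "inverted \<equiv> t ` Obj C"

lemma inverted_Arr: "inverted \<subseteq> Arr C"
  using t_Mor by (auto simp: Mor_def)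

lemma t_Dom_Cod: "X \<in> Obj C \<Longrightarrow> Dom C (t X) = X" "X \<in> Obj C \<Longrightarrow> Cod C (t X) = X"
  using t_Mor by (auto simp: Mor_def)

lemma numerator_Mor: "is_zigzag C inverted X as Y \<Longrightarrow> numerator C X as \<in> Mor C X Y"
proof (induction as arbitrary: X)
  case (Cons a as)
  then show ?case
    by (cases a) (auto simp: t_Dom_Cod Mor_def intro!: Comp_Mor[unfolded Mor_def, simplified])
qed (auto intro: Ident_Mor)

lemma numerator_append:
  assumes "is_zigzag C inverted X as Y" "is_zigzag C inverted Y bs Z"
  shows "numerator C X (as @ bs) = numerator C Y bs \<cdot> numerator C X as"
  using assms(1)
proof (induction as arbitrary: X)
  case Nil
  then show ?case using Comp_Ident[OF numerator_Mor[OF assms(2)]] by auto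
next
  case (Cons a as)
  show ?case
  proof (cases a)
    case (Fwd f)
    then have "f \<in> Mor C X (Cod C f)" "is_zigzag C inverted (Cod C f) as Y"
      using Cons.prems by (auto simp: Mor_def)
    then show ?thesis
      using Cons.IH Fwd Comp_assoc[OF _ numerator_Mor numerator_Mor[OF assms(2)]] by simp
  next
    case (Bwd s)
    then show ?thesis using Cons by auto
  qed
qed

lemma Pow_t_Suc:
  assumes "X \<in> Obj C"
  shows "Pow_arr C X (t X) (Suc n) = Pow_arr C X (t X) n \<cdot> t X"
  using t_natural[OF Pow_arr_Mor[OF t_Mor[OF assms]]] by simp

text \<open>Cancelling \<open>s\<close> against its formal inverse removes one factor \<open>t\<close> from the numerator, and
  naturality moves this factor to the end of the zigzag. The other rules preserve the
  numerator.\<close>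

lemma numerator_rule:
  assumes "zigzag_rule C inverted l r" "us @ l @ vs \<in> zigzags C inverted X Y"
  shows "numerator C X (us @ l @ vs) = numerator C X (us @ r @ vs) \<or>
    numerator C X (us @ l @ vs) = t Y \<cdot> numerator C X (us @ r @ vs)"
proof -
  note app = zigzag_append[OF category_axioms inverted_Arr]
  obtain P Q where z: "is_zigzag C inverted X us P" "is_zigzag C inverted P l Q"
      "is_zigzag C inverted Q vs Y"
    using assms(2) by (auto simp: zigzags_def app)
  have P: "P \<in> Obj C" using zigzag_Obj[OF category_axioms inverted_Arr z(1)] by blast
  have r: "is_zigzag C inverted P r Q \<and>
    (numerator C P l = numerator C P r \<or> numerator C P l = t Q \<cdot> numerator C P r)"
    using assms(1)
  proof cases
    case (rule_ident W)
    then show ?thesis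
      using z(2) Ident_Mor[of W] Comp_Ident[OF Ident_Mor[of W]] by (auto simp: Mor_def)
  next
    case (rule_comp f g)
    then have fg: "f \<in> Mor C P (Dom C g)" "g \<in> Mor C (Dom C g) Q" and Q: "Q \<in> Obj C"
      using z(2) by (auto simp: Mor_def)
    then show ?thesis
      using rule_comp Comp_Mor[OF fg] Comp_assoc[OF fg Ident_Mor[OF Q]] by (auto simp: Mor_def)
  next
    case (rule_inv_left s)
    then show ?thesis
      using z(2) P Ident_Comp[OF t_Mor[OF P]] Comp_Ident[OF t_Mor[OF P]] by (auto simp: t_Dom_Cod)
  next
    case (rule_inv_right s)
    then show ?thesis
      using z(2) P Ident_Comp[OF t_Mor[OF P]] Comp_Ident[OF t_Mor[OF P]] by (auto simp: t_Dom_Cod)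
  qed
  note n = numerator_Mor[OF z(1)] numerator_Mor[OF conjunct1[OF r]] numerator_Mor[OF z(3)]
  have split: "numerator C X (us @ k @ vs) = (numerator C Q vs \<cdot> numerator C P k) \<cdot> numerator C X us"
    if k: "is_zigzag C inverted P k Q" for k
  proof -
    have "is_zigzag C inverted P (k @ vs) Y" using k z(3) by (auto simp: app)
    then show ?thesis
      using numerator_append[OF z(1)] numerator_append[OF k z(3)] by simp
  qed
  have O: "Q \<in> Obj C" "Y \<in> Obj C" using n Mor_Obj by auto
  note tm = t_Mor[OF O(1)] t_Mor[OF O(2)]
  have "(numerator C Q vs \<cdot> (t Q \<cdot> numerator C P r)) \<cdot> numerator C X us
      = ((t Y \<cdot> numerator C Q vs) \<cdot> numerator C P r) \<cdot> numerator C X us"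
    using Comp_assoc[OF n(2) tm(1) n(3)] t_natural[OF n(3)] by simp
  also have "\<dots> = t Y \<cdot> ((numerator C Q vs \<cdot> numerator C P r) \<cdot> numerator C X us)"
    using Comp_assoc[OF n(2,3) tm(2)] Comp_assoc[OF n(1) Comp_Mor[OF n(2,3)] tm(2)] by simp
  finally show ?thesis
    using r split[of r] split[OF z(2)] by auto
qed

text \<open>Each rewriting step multiplies the numerator by \<open>t\<close>, divides it by \<open>t\<close>, or keeps it, and the
  numerator of the empty zigzag is \<open>t ^ 0\<close>. The factor \<open>t ^ k\<close> is needed since \<open>t\<close> cannot be
  cancelled in \<open>C\<close>.\<close>

lemma trivial_zigzag_numerator:
  assumes "([], as) \<in> zigzag_equiv C inverted X X"
  shows "\<exists>k n. Pow_arr C X (t X) k \<cdot> numerator C X as = Pow_arr C X (t X) n"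
proof -
  let ?S = "zigzag_step C inverted X X"
  let ?T = "Pow_arr C X (t X)"
  have "[] \<in> zigzags C inverted X X" using assms by (auto simp: zigzag_equiv_def)
  then have X: "X \<in> Obj C" by (simp add: zigzags_def)
  note T = Pow_arr_Mor[OF t_Mor[OF X]]
  have "([], as) \<in> (?S \<union> ?S\<inverse>)\<^sup>*"
    using assms by (simp add: zigzag_equiv_def)
  then show ?thesis
  proof induction
    case base
    have "?T 0 \<cdot> numerator C X [] = ?T 0"
      using Comp_Ident[OF Ident_Mor[OF X]] by simp
    then show ?case by blast
  next
    case (step bs cs)
    then obtain k n where kn: "?T k \<cdot> numerator C X bs = ?T n" by blast
    from step.hyps(2) show ?case
    proof
      assume "(bs, cs) \<in> ?S"
      then obtain us l r vs where *: "bs = us @ l @ vs" "cs = us @ r @ vs"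
          "zigzag_rule C inverted l r" "bs \<in> zigzags C inverted X X" "cs \<in> zigzags C inverted X X"
        unfolding zigzag_step_def by blast
      then have c: "numerator C X cs \<in> Mor C X X" using numerator_Mor by (simp add: zigzags_def)
      have "numerator C X bs = numerator C X cs \<or> numerator C X bs = t X \<cdot> numerator C X cs"
        using numerator_rule *(1-4) by blast
      moreover have "?T k \<cdot> (t X \<cdot> numerator C X cs) = ?T (Suc k) \<cdot> numerator C X cs"
        using Comp_assoc[OF c t_Mor[OF X] T] Pow_t_Suc[OF X] by simp
      ultimately show ?thesis using kn by metis
    next
      assume "(bs, cs) \<in> ?S\<inverse>"
      then obtain us l r vs where *: "cs = us @ l @ vs" "bs = us @ r @ vs"
          "zigzag_rule C inverted l r" "cs \<in> zigzags C inverted X X" "bs \<in> zigzags C inverted X X"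
        unfolding zigzag_step_def by blast
      then have b: "numerator C X bs \<in> Mor C X X" using numerator_Mor by (simp add: zigzags_def)
      have "numerator C X cs = numerator C X bs \<or> numerator C X cs = t X \<cdot> numerator C X bs"
        using numerator_rule *(1-4) by blast
      moreover have "?T k \<cdot> (t X \<cdot> numerator C X bs) = ?T (Suc n)"
        using Comp_assoc[OF b t_Mor[OF X] T[of k]] Comp_assoc[OF b T[of k] t_Mor[OF X]]
          Pow_t_Suc[OF X, of k] kn
        by (metis Pow_arr.simps(2))
      ultimately show ?thesis using kn by metis
    qed
  qed
qed

end

locale additive_central_endo = additive_category C + central_endo C t
  for C :: "('o, 'm, 'x) addcat_scheme" (structure) and t :: "'o \<Rightarrow> 'm"
begin

text \<open>If \<open>Q\<close> is isomorphic to \<open>Z\<close> in the localisation, a round trip from \<open>Q\<close> through \<open>Z\<close> is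
  equivalent to the empty zigzag and has numerator zero. Conversely, if \<open>t ^ n = 0\<close> on \<open>Q\<close>, then
  an isomorphism of the localisation factors through \<open>Z\<close>.\<close>

lemma zero_in_localisation_iff_nilpotent:
  assumes Q: "Q \<in> Obj C" and Z: "zero_object C Z"
  shows "isomorphic (gz_localisation C inverted) (on_Obj (gz_functor C inverted) Q)
      (on_Obj (gz_functor C inverted) Z) \<longleftrightarrow> nilpotent_endo C Q (t Q)"
proof
  let ?G = "gz_localisation C inverted" and ?p = "gz_functor C inverted"
  interpret p: cat_functor C ?G ?p
    using functor_gz[OF category_axioms inverted_Arr] .
  assume "isomorphic ?G (on_Obj ?p Q) (on_Obj ?p Z)"
  then obtain \<alpha> \<beta> where \<alpha>: "\<alpha> \<in> Mor ?G Q Z" and \<beta>: "\<beta> \<in> Mor ?G Z Q"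
      and \<beta>\<alpha>: "\<beta> \<cdot>\<^bsub>?G\<^esub> \<alpha> = Ident ?G Q"
    by (elim p.B.isomorphicE) (auto simp: gz_functor_def)
  obtain as bs where as: "as \<in> zigzags C inverted Q Z" "\<alpha> = gz_class C inverted Q Z as"
      and bs: "bs \<in> zigzags C inverted Z Q" "\<beta> = gz_class C inverted Z Q bs"
    using \<alpha> \<beta> unfolding gz_Mor by blast
  have "gz_class C inverted Q Q [] = gz_class C inverted Q Q (as @ bs)"
    using \<beta>\<alpha> gz_comp_class[OF category_axioms inverted_Arr as(1) bs(1)] as(2) bs(2)
    by (simp add: gz_localisation_def)
  moreover have "as @ bs \<in> zigzags C inverted Q Q"
    using zigzags_append[OF category_axioms inverted_Arr as(1) bs(1)] .
  moreover have "[] \<in> zigzags C inverted Q Q"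
    using Q by (simp add: zigzags_def)
  ultimately have "([], as @ bs) \<in> zigzag_equiv C inverted Q Q"
    using eq_equiv_class[OF _ zigzag_equiv_equiv] by (fastforce simp: gz_class_def)
  then obtain k n where kn: "Pow_arr C Q (t Q) k \<cdot> numerator C Q (as @ bs) = Pow_arr C Q (t Q) n"
    using trivial_zigzag_numerator by blast
  have "numerator C Q (as @ bs) = Zero C Q Q"
    using numerator_append numerator_Mor through_zero_object[OF Z] as(1) bs(1)
    by (simp add: zigzags_def)
  then have "Pow_arr C Q (t Q) n = Zero C Q Q"
    using kn Comp_Zero[OF Q Pow_arr_Mor[OF t_Mor[OF Q]]] by simp
  then show "nilpotent_endo C Q (t Q)"
    using t_Mor[OF Q] unfolding nilpotent_endo_def by blast
next
  let ?G = "gz_localisation C inverted" and ?p = "gz_functor C inverted"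
  interpret p: cat_functor C ?G ?p
    using functor_gz[OF category_axioms inverted_Arr] .
  assume "nilpotent_endo C Q (t Q)"
  then obtain n where n: "Pow_arr C Q (t Q) n = Zero C Q Q"
    unfolding nilpotent_endo_def by blast
  have ZO: "Z \<in> Obj C" using Z by (simp add: zero_object_def)
  let ?a = "Zero C Q Z" and ?b = "Zero C Z Q"
  note a = Zero_Mor[OF Q ZO] and b = Zero_Mor[OF ZO Q]
  note pa = p.on_Arr[OF a] and pb = p.on_Arr[OF b]
  have "iso_arrow ?G (on_Arr ?p (Pow_arr C Q (t Q) n))"
    using p.on_Pow_arr[OF t_Mor[OF Q]] p.B.Pow_arr_iso[OF p.on_Arr[OF t_Mor[OF Q]]]
      gz_functor_inverts[OF category_axioms inverted_Arr, of "t Q"] Q by simp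
  then have iso: "iso_arrow ?G (on_Arr ?p ?b \<cdot>\<^bsub>?G\<^esub> on_Arr ?p ?a)"
    using n p.on_Comp[OF a b] Comp_Zero[OF Q b] by simp
  note u = inv_arrow[OF iso p.B.Comp_Mor[OF pa pb]]
  show "isomorphic ?G (on_Obj ?p Q) (on_Obj ?p Z)"
  proof (rule p.B.isomorphicI_left_right[OF pa p.B.Comp_Mor[OF pb u(1)] pb])
    show "(inv_arrow ?G (on_Arr ?p ?b \<cdot>\<^bsub>?G\<^esub> on_Arr ?p ?a) \<cdot>\<^bsub>?G\<^esub> on_Arr ?p ?b) \<cdot>\<^bsub>?G\<^esub> on_Arr ?p ?a
        = Ident ?G (on_Obj ?p Q)"
      using p.B.Comp_assoc[OF pa pb u(1)] u(2) by simp
    \<comment> \<open>On a zero object the zero arrow is the identity, so \<open>b\<close> is a right inverse of \<open>a\<close>.\<close>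
    have "?a \<cdot> ?b = Ident C Z"
      using Comp_Zero[OF ZO a] Z zero_object_iff by simp
    then show "on_Arr ?p ?a \<cdot>\<^bsub>?G\<^esub> on_Arr ?p ?b = Ident ?G (on_Obj ?p Z)"
      using p.on_Comp[OF b a] p.on_Ident[OF ZO] by simp
  qed
qed

end


section \<open>Degenerations of the zero object\<close>

context degeneration_data
begin

lemma CatV0_triangulated: "triangulated_category (CatV0 D)"
  using SubV_sub by (simp add: full_triangulated_sub_def CatV0_def)

lemma CatV0_Obj: "Obj (CatV0 D) = SubV D"
  by (simp add: CatV0_def full_sub_def)

lemma CatV0_Mor: "\<lbrakk>X \<in> SubV D; Y \<in> SubV D\<rbrakk> \<Longrightarrow> Mor (CatV0 D) X Y = Mor (CatV D) X Y"
  by (auto simp: CatV0_def full_sub_def Mor_def)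

lemma CatV0_central_endo: "additive_central_endo (CatV0 D) (tee D)"
proof -
  interpret V: triangulated_category "CatV0 D" by (rule CatV0_triangulated)
  have S: "SubV D \<subseteq> Obj (CatV D)" using SubV_sub by (simp add: full_triangulated_sub_def)
  show ?thesis
  proof (intro additive_central_endo.intro central_endo.intro central_endo_axioms.intro
      V.additive_category_axioms V.category_axioms)
    show "tee D X \<in> Mor (CatV0 D) X X" if "X \<in> Obj (CatV0 D)" for X
      using that tee_natural S CatV0_Mor unfolding CatV0_Obj tri_nat_endo_id_def by blast
    show "tee D Y \<cdot>\<^bsub>CatV0 D\<^esub> f = f \<cdot>\<^bsub>CatV0 D\<^esub> tee D X" if "f \<in> Mor (CatV0 D) X Y" for f X Y
    proof -
      have "X \<in> SubV D" "Y \<in> SubV D" using V.Mor_Obj[OF that] CatV0_Obj by auto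
      then have "tee D Y \<cdot>\<^bsub>CatV D\<^esub> f = f \<cdot>\<^bsub>CatV D\<^esub> tee D X"
        using that tee_natural S CatV0_Mor unfolding tri_nat_endo_id_def by blast
      then show ?thesis by (simp add: CatV0_def full_sub_def)
    qed
  qed
qed

lemma up_zero_object:
  assumes "zero_object C Z"
  shows "zero_object (CatV0 D) (up_obj D Z)"
proof -
  interpret E: triangulated_functor C "CatK D" "EmbK D" by (rule EmbK_triangulated)
  interpret U: triangulated_functor "CatK D" "CatV D" "Up D" by (rule Up_triangulated)
  have "zero_object (CatV D) (up_obj D Z)"
    unfolding up_obj_def
    by (intro U.zero_object_on_Obj E.zero_object_on_Obj assms E.A.additive_category_axioms
        E.B.additive_category_axioms U.B.additive_category_axioms)
  moreover have "up_obj D Z \<in> SubV D" using Up_SubV assms by (simp add: zero_object_def)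
  moreover have "SubV D \<subseteq> Obj (CatV D)" using SubV_sub by (simp add: full_triangulated_sub_def)
  ultimately show ?thesis
    using CatV0_Mor unfolding zero_object_def CatV0_Obj by (simp add: subset_iff)
qed

lemma cdeg_condition_zero_iff:
  assumes "zero_object C Z" "Q \<in> SubV D"
  shows "isomorphic (gz_localisation (CatV0 D) (tee_arrows D))
      (on_Obj (gz_functor (CatV0 D) (tee_arrows D)) Q)
      (on_Obj (gz_functor (CatV0 D) (tee_arrows D)) (up_obj D Z)) \<longleftrightarrow>
    nilpotent_endo (CatV0 D) Q (tee D Q)"
  using additive_central_endo.zero_in_localisation_iff_nilpotent[OF CatV0_central_endo, of Q "up_obj D Z"]
    assms up_zero_object by (simp add: CatV0_Obj tee_arrows_def)

lemma cone_Phi_tee: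
  assumes "Q \<in> SubV D"
  shows "isomorphic (CatK D) (cone (CatK D) (on_Arr (Phi D) (tee D Q)))
    (on_Obj (Phi D) (cone (CatV0 D) (tee D Q)))"
proof -
  interpret t: additive_central_endo "CatV0 D" "tee D" by (rule CatV0_central_endo)
  show ?thesis
    using triangulated_functor.cone_on_Arr[OF Phi_triangulated] t.inverted_Arr assms CatV0_Obj
    by blast
qed

text \<open>The functor \<open>\<Phi>\<close> preserves the nilpotence of \<open>t\<^sub>Q\<close>, and the cone of \<open>\<Phi>(t\<^sub>Q)\<close> is \<open>N\<close>, so the
  criterion for the essential image applies.\<close>

lemma Phi_in_ess_image_EmbK:
  assumes split: "split_idempotents C" and N: "N \<in> Obj C" and Q: "Q \<in> SubV D"
    and nil: "nilpotent_endo (CatV0 D) Q (tee D Q)"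
    and iso: "isomorphic (CatK D) (on_Obj (Phi D) (cone (CatV0 D) (tee D Q))) (on_Obj (EmbK D) N)"
  shows "\<exists>X \<in> Obj C. isomorphic (CatK D) (on_Obj (EmbK D) X) (on_Obj (Phi D) Q)"
proof -
  interpret E: triangulated_embedding C "CatK D" "EmbK D"
    by (intro triangulated_embedding.intro triangulated_embedding_axioms.intro EmbK_triangulated
        EmbK_fully_faithful)
  interpret P: triangulated_functor "CatV0 D" "CatK D" "Phi D" by (rule Phi_triangulated)
  have "nilpotent_endo (CatK D) (on_Obj (Phi D) Q) (on_Arr (Phi D) (tee D Q))"
    using P.nilpotent_on_Arr[OF P.A.additive_category_axioms E.B.additive_category_axioms nil] .
  moreover have "cone (CatK D) (on_Arr (Phi D) (tee D Q)) \<in> E.ess_image"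
    using E.ess_image_on_Obj[OF N] E.ess_image_iso cone_Phi_tee[OF Q] iso
    by (meson E.B.isomorphic_sym E.B.isomorphic_trans)
  ultimately show ?thesis
    using E.ess_image_nilpotent[OF split] by (simp add: E.ess_image_def)
qed

end

theorem proposition9:
  fixes K :: "('k, 'r) ring_scheme"
    and C :: "('o, 'm) tricat"
    and sm :: "'k \<Rightarrow> 'm \<Rightarrow> 'm"
    and Z N :: 'o
  assumes "linear_triangulated_category K C sm"
    and "split_idempotents C"
    and "zero_object C Z"
    and "N \<in> Obj C"
  shows "cdeg_le TYPE('ok \<times> 'mk) TYPE('ov \<times> 'mv) C Z N \<longleftrightarrow>
    (\<exists>(D :: ('o, 'm, 'ok, 'mk, 'ov, 'mv) degen_data) Q.
       degeneration_data C D \<and> Q \<in> SubV D \<and>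
       nilpotent_endo (CatV0 D) Q (tee D Q) \<and>
       isomorphic (CatK D) (cone (CatK D) (on_Arr (Phi D) (tee D Q)))
         (on_Obj (Phi D) (cone (CatV0 D) (tee D Q))) \<and>
       isomorphic (CatK D) (on_Obj (Phi D) (cone (CatV0 D) (tee D Q))) (on_Obj (EmbK D) N) \<and>
       (\<exists>X \<in> Obj C. isomorphic (CatK D) (on_Obj (EmbK D) X) (on_Obj (Phi D) Q)))"
proof -
  have "Z \<in> Obj C" using assms(3) by (simp add: zero_object_def)
  moreover note nil = degeneration_data.cdeg_condition_zero_iff[OF _ assms(3)]
    and cone = degeneration_data.cone_Phi_tee
    and ess = degeneration_data.Phi_in_ess_image_EmbK[OF _ assms(2,4)]
  ultimately show ?thesis
    using assms(4) unfolding cdeg_le_def by (metis (no_types, lifting))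
qed

end
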